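(* For every $n\ge 1$, the Alexander capacity of the set $\mathbb{RP}^n$ of real points of complex projective space $\mathbb{P}^n$ is $$T_\omega(\mathbb{RP}^n)=\frac{1}{\sqrt2}.$$
   Context: Let $u_0(z):=\frac12\log(1+|z|^2)$ on $\mathbb{C}^n$, identified with the affine chart $\{[1:z_1:\cdots:z_n]\}$ of $\mathbb{P}^n$. Let $\omega$ be the Fubini-Study K\"ahler form on $\mathbb{P}^n$ normalized so that $\int_{\mathbb{P}^n}\omega^n=1$, with $dd^c=\frac{i}{\pi}\partial\bar\partial$, so that $\omega=dd^cu_0$ on $\mathbb{C}^n$. Define $$PSH(\mathbb{P}^n,\omega):=\{\phi\in L^1(\mathbb{P}^n):\ \phi\text{ upper semicontinuous},\ dd^c\phi+\omega\ge 0\}.$$ For a closed set $K\subset\mathbb{P}^n$, the $\omega$-psh extremal function is $$v_{K,0}(\mathbf{z}):=\sup\{\phi(\mathbf{z}):\ \phi\in PSH(\mathbb{P}^n,\omega),\ \phi\le 0\text{ on }K\},$$ and the Alexander capacity of $K$ is $$T_\omega(K):=\exp\bigl[-\sup_{\mathbb{P}^n}v_{K,0}\bigr].$$ *)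

theory Defs
  imports "HOL-Analysis.Analysis"
begin

section \<open>Complex projective space\<close>

text \<open>
  For a finite index type \<open>'n\<close> with \<open>CARD('n) = n\<close>, the type \<open>'n option\<close> indexes the \<open>n + 1\<close>
  homogeneous coordinates; \<open>None\<close> is the index \<open>0\<close>.
\<close>

definition proportional :: "complex ^ 'm \<Rightarrow> complex ^ 'm \<Rightarrow> bool" where
  "proportional Z W \<longleftrightarrow> Z \<noteq> 0 \<and> W \<noteq> 0 \<and> (\<exists>c. c \<noteq> 0 \<and> W = c *s Z)"

quotient_type (overloaded) 'n cproj = "complex ^ ('n::finite) option" / partial: proportional
  morphisms cproj_rep hom_point
proof (rule part_equivpI)
  show "\<exists>Z :: complex ^ 'n option. proportional Z Z"
    by (rule exI[of _ 1]) (auto simp: proportional_def intro!: exI[of _ 1])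
  show "symp (proportional :: complex ^ 'n option \<Rightarrow> _)"
  proof (rule sympI)
    fix Z W :: "complex ^ 'n option"
    assume "proportional Z W"
    then obtain c where c: "Z \<noteq> 0" "W \<noteq> 0" "c \<noteq> 0" "W = c *s Z"
      by (auto simp: proportional_def)
    have "Z = inverse c *s W"
      using c by (simp add: vec_eq_iff)
    with c show "proportional W Z"
      unfolding proportional_def by (metis inverse_nonzero_iff_nonzero)
  qed
  show "transp (proportional :: complex ^ 'n option \<Rightarrow> _)"
  proof (rule transpI)
    fix X Y Z :: "complex ^ 'n option"
    assume "proportional X Y" "proportional Y Z"
    then obtain c d where "X \<noteq> 0" "Z \<noteq> 0" "c \<noteq> 0" "d \<noteq> 0" "Y = c *s X" "Z = d *s Y"
      by (auto simp: proportional_def)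
    then show "proportional X Z"
      by (auto simp: proportional_def intro!: exI[of _ "d * c"])
  qed
qed

text \<open>The topology is the quotient topology from the nonzero vectors.\<close>

instantiation cproj :: (finite) topological_space
begin

definition open_cproj :: "'a cproj set \<Rightarrow> bool" where
  "open_cproj U \<longleftrightarrow> open {Z. Z \<noteq> 0 \<and> hom_point Z \<in> U}"

instance
proof
  have "{Z :: complex ^ 'a option. Z \<noteq> 0 \<and> hom_point Z \<in> UNIV} = - {0}"
    by auto
  then show "open (UNIV :: 'a cproj set)"
    by (simp only: open_cproj_def) (simp add: open_Compl)
next
  fix S T :: "'a cproj set"
  assume "open S" "open T"
  moreover have "{Z. Z \<noteq> 0 \<and> hom_point Z \<in> S \<inter> T} =
      {Z. Z \<noteq> 0 \<and> hom_point Z \<in> S} \<inter> {Z. Z \<noteq> 0 \<and> hom_point Z \<in> T}"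
    by auto
  ultimately show "open (S \<inter> T)"
    by (simp add: open_cproj_def open_Int)
next
  fix K :: "'a cproj set set"
  assume "\<forall>S\<in>K. open S"
  moreover have "{Z. Z \<noteq> 0 \<and> hom_point Z \<in> \<Union>K} =
      (\<Union>S\<in>K. {Z. Z \<noteq> 0 \<and> hom_point Z \<in> S})"
    by auto
  ultimately show "open (\<Union>K)"
    by (simp add: open_cproj_def open_UN)
qed

end

definition affine_lift :: "complex ^ 'n \<Rightarrow> complex ^ ('n::finite) option" where
  "affine_lift z = (\<chi> i. case i of None \<Rightarrow> 1 | Some k \<Rightarrow> z $ k)"

text \<open>
  The standard atlas. \<open>affine_chart None z\<close> is \<open>[1 : z\<^sub>1 : \<dots> : z\<^sub>n]\<close>; the chart with index \<open>j\<close>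
  parametrizes the points with nonvanishing \<open>j\<close>-th coordinate and is obtained from this one by
  exchanging the homogeneous coordinates \<open>None\<close> and \<open>j\<close>.
\<close>

definition affine_chart :: "'n option \<Rightarrow> complex ^ 'n \<Rightarrow> ('n::finite) cproj" where
  "affine_chart j z = hom_point (\<chi> i. affine_lift z $ Transposition.transpose None j i)"

definition real_points :: "('n::finite) cproj set" where
  "real_points = {hom_point Z | Z. Z \<noteq> 0 \<and> (\<forall>i. Z $ i \<in> \<real>)}"

lemma hom_point_eq_iff:
  assumes "Z \<noteq> 0" "W \<noteq> 0"
  shows "hom_point Z = hom_point W \<longleftrightarrow> (\<exists>c. c \<noteq> 0 \<and> W = c *s Z)"
proof -
  have "proportional X X" if "X \<noteq> 0" for X :: "complex ^ 'a option"
    using that by (auto simp: proportional_def intro!: exI[of _ 1])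
  then have "hom_point Z = hom_point W \<longleftrightarrow> proportional Z W"
    using Quotient3_rel[OF Quotient3_cproj, of Z W] assms by blast
  then show ?thesis
    using assms by (simp add: proportional_def)
qed

lemma affine_chart_lift_nonzero:
  "(\<chi> i. affine_lift z $ Transposition.transpose None j i) \<noteq> 0"
  by (auto simp: vec_eq_iff affine_lift_def intro!: exI[of _ j])

lemma continuous_affine_chart: "continuous_on UNIV (affine_chart j)"
proof -
  have "open (affine_chart j -` U)" if U: "open U" for U :: "'a cproj set"
  proof -
    let ?L = "\<lambda>z. \<chi> i. affine_lift z $ Transposition.transpose None j i"
    have *: "continuous_on UNIV (\<lambda>z :: complex ^ 'a. affine_lift z $ i)" for i
      by (cases i) (auto simp: affine_lift_def intro!: continuous_intros)
    have "continuous_on UNIV ?L"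
      by (intro continuous_on_vec_lambda *)
    moreover have "affine_chart j -` U = ?L -` {Z. Z \<noteq> 0 \<and> hom_point Z \<in> U}"
      using affine_chart_lift_nonzero[of _ j] by (auto simp: affine_chart_def)
    moreover have "open {Z. Z \<noteq> 0 \<and> hom_point Z \<in> U}"
      using U by (simp only: open_cproj_def)
    ultimately show ?thesis
      by (simp only: open_vimage)
  qed
  then show ?thesis
    by (simp add: continuous_on_open_vimage)
qed

lemma measurable_affine_chart: "affine_chart j \<in> lborel \<rightarrow>\<^sub>M borel"
  using borel_measurable_continuous_onI[OF continuous_affine_chart] by simp

section \<open>Plurisubharmonic functions\<close>

definition usc_on :: "'a::topological_space set \<Rightarrow> ('a \<Rightarrow> ereal) \<Rightarrow> bool" where
  "usc_on S f \<longleftrightarrow> (\<forall>c. openin (top_of_set S) {x \<in> S. f x < c})"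

text \<open>
  The integral of an extended real function, as the difference of the integrals of its positive
  and negative parts (\<open>e2ennreal\<close> sends negative numbers to \<open>0\<close>). It is meaningful whenever the
  positive part has finite integral, and may then be \<open>-\<infinity>\<close>.
\<close>

definition ereal_integral :: "'a measure \<Rightarrow> ('a \<Rightarrow> ereal) \<Rightarrow> ereal" where
  "ereal_integral M f =
     enn2ereal (\<integral>\<^sup>+x. e2ennreal (f x) \<partial>M) - enn2ereal (\<integral>\<^sup>+x. e2ennreal (- f x) \<partial>M)"

text \<open>The function that is identically \<open>-\<infinity>\<close> is not excluded here.\<close>

definition psh_on :: "(complex ^ 'n) set \<Rightarrow> (complex ^ ('n::finite) \<Rightarrow> ereal) \<Rightarrow> bool" where
  "psh_on \<Omega> u \<longleftrightarrow>
     open \<Omega> \<and> (\<forall>z\<in>\<Omega>. u z < \<infinity>) \<and> usc_on \<Omega> u \<and>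
     (\<forall>a b. (\<forall>\<zeta>. cmod \<zeta> \<le> 1 \<longrightarrow> a + \<zeta> *s b \<in> \<Omega>) \<longrightarrow>
        u a \<le> ereal_integral (uniform_measure lborel {0..2 * pi}) (\<lambda>\<theta>. u (a + cis \<theta> *s b)))"

section \<open>Functions plurisubharmonic relative to the Fubini--Study form\<close>

definition u0 :: "complex ^ ('n::finite) \<Rightarrow> real" where
  "u0 z = ln (1 + (norm z)\<^sup>2) / 2"

text \<open>
  The measure \<open>\<omega>\<^sup>n\<close>. With \<open>dd\<^sup>c = (i/\<pi>) \<partial>\<partial>\<close>-bar, the form \<open>(dd\<^sup>c u0)\<^sup>n\<close> on \<open>\<complex>\<^sup>n\<close> has the density below
  with respect to Lebesgue measure, of total mass \<open>1\<close>; the complement of the affine chart has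
  measure zero.
\<close>

definition fs_measure :: "('n::finite) cproj measure" where
  "fs_measure = distr
     (density lborel (\<lambda>z :: complex ^ 'n.
        ennreal (fact CARD('n) / (pi ^ CARD('n) * (1 + (norm z)\<^sup>2) ^ (CARD('n) + 1)))))
     borel (affine_chart None)"

definition L1_fs :: "(('n::finite) cproj \<Rightarrow> ereal) \<Rightarrow> bool" where
  "L1_fs \<phi> \<longleftrightarrow> \<phi> \<in> borel_measurable fs_measure \<and>
     (\<integral>\<^sup>+x. e2ennreal \<bar>\<phi> x\<bar> \<partial>fs_measure) < \<infinity>"

text \<open>
  The condition \<open>dd\<^sup>c \<phi> + \<omega> \<ge> 0\<close>. The form \<open>\<omega>\<close> is invariant under permutations of the homogeneous
  coordinates, so in each chart of the standard atlas it is \<open>dd\<^sup>c u0\<close>, and the condition says that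
  \<open>dd\<^sup>c (u0 + \<phi>) \<ge> 0\<close> there. As usual for upper semicontinuous functions this means that
  \<open>u0 + \<phi>\<close> is plurisubharmonic at every point. Positivity of the current alone would not be
  enough: it does not change when \<open>\<phi>\<close> is raised on a closed null set, and then every extremal
  function would be \<open>\<infinity>\<close> off \<open>K\<close>.
\<close>

definition ddc_plus_omega_nonneg :: "(('n::finite) cproj \<Rightarrow> ereal) \<Rightarrow> bool" where
  "ddc_plus_omega_nonneg \<phi> \<longleftrightarrow> (\<forall>j. psh_on UNIV (\<lambda>z. ereal (u0 z) + \<phi> (affine_chart j z)))"

definition PSH_omega :: "(('n::finite) cproj \<Rightarrow> ereal) set" where
  "PSH_omega = {\<phi>. L1_fs \<phi> \<and> (\<forall>x. \<phi> x < \<infinity>) \<and> usc_on UNIV \<phi> \<and> ddc_plus_omega_nonneg \<phi>}"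

section \<open>Extremal function and Alexander capacity\<close>

definition extremal_function :: "('n::finite) cproj set \<Rightarrow> 'n cproj \<Rightarrow> ereal" where
  "extremal_function K x = (SUP \<phi> \<in> {\<phi> \<in> PSH_omega. \<forall>y\<in>K. \<phi> y \<le> 0}. \<phi> x)"

text \<open>
  The supremum is never negative, because the constant \<open>0\<close> is a competitor; if it is \<open>\<infinity>\<close> then
  \<open>exp (- \<infinity>) = 0\<close>.
\<close>

definition alexander_capacity :: "('n::finite) cproj set \<Rightarrow> real" where
  "alexander_capacity K =
     (let M = (SUP x. extremal_function K x) in if M = \<infinity> then 0 else exp (- real_of_ereal M))"

end

theory Submission
  imports Defs "HOL-Complex_Analysis.Cauchy_Integral_Formula"
begin

text \<open>
  Write \<open>\<Phi>(Z) = \<phi>([Z]) + log \<bar>Z\<bar>\<close> for the function on \<open>\<complex>\<^sup>n\<^sup>+\<^sup>1 - {0}\<close> attached to a competitor \<open>\<phi>\<close>. It is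
  plurisubharmonic, logarithmically homogeneous, and at most \<open>log \<bar>Z\<bar>\<close> at real \<open>Z\<close>. The claim is that
  \<open>\<Phi>(Z) - log \<bar>Z\<bar>\<close> has the least upper bound \<open>(log 2) / 2\<close>, over all competitors and all \<open>Z\<close>.
  
  For the upper bound, a point that is not real lies on exactly one real projective line. In a chart that
  line is \<open>\<zeta> \<mapsto> a + \<zeta> b\<close> with \<open>a\<close>, \<open>b\<close> real, and the point can be taken at \<open>\<zeta> = i\<close>. The real
  quadratic polynomial \<open>1 + \<bar>a + \<zeta> b\<bar>\<^sup>2\<close> of a real \<open>\<zeta>\<close> has no real root, so it equals
  \<open>\<gamma> \<bar>\<zeta> - \<rho>\<bar>\<^sup>2\<close> on the real axis for some \<open>\<rho>\<close> in the lower half plane. Hence \<open>\<Phi>\<close>, restricted to the line,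
  is a subharmonic function that is bounded on the real axis by \<open>h = log (\<surd>\<gamma> \<bar>\<zeta> - \<rho>\<bar>)\<close>, which is
  harmonic on the closed upper half plane, and \<open>\<Phi> - h\<close> is bounded above there, because \<open>\<phi>\<close> is bounded
  above on the compact space. The Phragmen--Lindeloef principle (lemma
  \<open>phragmen_lindelof\<close>) gives \<open>\<Phi> \<le> h\<close>, and an elementary computation gives
  \<open>h \<le> log \<bar>Z\<bar> + (log 2) / 2\<close> at \<open>\<zeta> = i\<close>. This is lemma \<open>competitor_le\<close>.
  
  For the lower bound, take \<open>\<Phi>(Z) = log (max \<bar>Z\<bar> \<bar>\<ell>(Z)\<bar>)\<close> with the linear form \<open>\<ell>(Z) = Z\<^sub>0 + i Z\<^sub>k\<close>. On real
  vectors \<open>\<bar>\<ell>(Z)\<bar> \<le> \<bar>Z\<bar>\<close>, while \<open>\<bar>\<ell>(Z)\<bar> = \<surd>2 \<bar>Z\<bar>\<close> where \<open>Z\<^sub>0 = 1\<close>, \<open>Z\<^sub>k = -i\<close> and all other coordinates are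
  \<open>0\<close>. The maximum of \<open>\<bar>Z\<bar>\<close> and \<open>\<bar>\<ell>(Z)\<bar>\<close> is a supremum of moduli of linear forms, and so its logarithm is
  plurisubharmonic (lemma \<open>competitor_PSH_omega\<close>).
\<close>

section \<open>Means over the unit circle\<close>

abbreviation circ :: "real measure" where
  "circ \<equiv> uniform_measure lborel {0..2 * pi}"

lemma finite_measure_circ: "finite_measure circ"
  by (rule finite_measureI) (simp add: emeasure_uniform_measure_1)

lemma circ_prob: "measure circ UNIV = 1"
  by (subst measure_uniform_measure) auto

lemma AE_circ: "(AE \<theta> in circ. P \<theta>) \<longleftrightarrow> (AE \<theta> in lborel. \<theta> \<in> {0..2 * pi} \<longrightarrow> P \<theta>)"
  by (subst AE_uniform_measure) auto

lemma integral_circ: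
  fixes g :: "real \<Rightarrow> real"
  assumes "continuous_on UNIV g"
  shows "integrable circ g" and "integral\<^sup>L circ g = integral {0..2 * pi} g / (2 * pi)"
proof -
  have m [measurable]: "g \<in> borel_measurable lborel"
    using borel_measurable_continuous_onI[OF assms] by simp
  have cg: "continuous_on {0..2 * pi} g"
    using assms continuous_on_subset by blast
  then have "bounded (g ` {0..2 * pi})"
    by (intro compact_imp_bounded compact_continuous_image) auto
  then obtain B where B: "\<bar>g \<theta>\<bar> \<le> B" if "\<theta> \<in> {0..2 * pi}" for \<theta>
    unfolding bounded_iff by fastforce
  interpret finite_measure circ by (rule finite_measure_circ)
  show "integrable circ g"
    by (rule integrable_const_bound[of _ B]) (auto simp: AE_circ B)
  have "circ = density lborel (\<lambda>x. ennreal (indicator {0..2 * pi} x / (2 * pi)))"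
    unfolding uniform_measure_def
    using divide_ennreal[of 1 "2 * pi"] by (intro density_cong) (auto simp: indicator_def)
  then have "integral\<^sup>L circ g = (LINT x|lborel. (indicator {0..2 * pi} x / (2 * pi)) *\<^sub>R g x)"
    by (simp add: integral_density)
  also have "\<dots> = (LINT x:{0..2 * pi}|lborel. g x) / (2 * pi)"
    by (simp add: set_lebesgue_integral_def)
  also have "(LINT x:{0..2 * pi}|lborel. g x) = integral {0..2 * pi} g"
    using cg by (intro set_borel_integral_eq_integral borel_integrable_atLeastAtMost') auto
  finally show "integral\<^sup>L circ g = integral {0..2 * pi} g / (2 * pi)" .
qed

lemma ereal_integral_real:
  assumes "integrable M f"
  shows "ereal_integral M (\<lambda>x. ereal (f x)) = ereal (integral\<^sup>L M f)"
proof -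
  have fin: "(\<integral>\<^sup>+x. ennreal (f x) \<partial>M) < \<infinity>" "(\<integral>\<^sup>+x. ennreal (- f x) \<partial>M) < \<infinity>"
    using assms by (auto simp: real_integrable_def top.not_eq_extremum)
  have e: "e2ennreal (ereal x) = ennreal x" for x
    by (metis e2ennreal_ereal)
  have n: "enn2ereal X = ereal (enn2real X)" if "X < \<infinity>" for X
    using that by (metis enn2ereal_ennreal enn2real_nonneg ennreal_enn2real infinity_ennreal_def)
  show ?thesis
    unfolding ereal_integral_def real_lebesgue_integral_def[OF assms] e uminus_ereal.simps
    using fin by (simp add: n e)
qed

lemma ereal_integral_mono:
  assumes "\<And>x. f x \<le> g x"
  shows "ereal_integral M f \<le> ereal_integral M g"
  unfolding ereal_integral_def
  by (intro ereal_minus_mono nn_integral_mono)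
    (auto intro!: nn_integral_mono e2ennreal_mono simp: assms less_eq_ennreal.rep_eq[symmetric])

text \<open>
  The function \<open>f\<close> may be \<open>-\<infinity>\<close> on a large set. It is replaced by the larger \<open>max f (g - 1)\<close>, which is
  real, has the same two bounds, and differs from \<open>g\<close> by at most \<open>1\<close>. The arc \<open>{pi<..<2 * pi}\<close> is the lower half of
  a circle, where the maximum principle below finds strict inequality.
\<close>

lemma ereal_integral_circ_less:
  fixes f :: "real \<Rightarrow> ereal" and g :: "real \<Rightarrow> real"
  assumes f: "f \<in> borel_measurable borel" and g: "continuous_on UNIV g"
    and le: "\<And>\<theta>. f \<theta> \<le> ereal (g \<theta>)"
    and less: "\<And>\<theta>. \<theta> \<in> {pi<..<2 * pi} \<Longrightarrow> f \<theta> < ereal (g \<theta>)"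
  shows "ereal_integral circ f < ereal (integral\<^sup>L circ g)"
proof -
  define f' where "f' \<theta> = real_of_ereal (max (f \<theta>) (ereal (g \<theta> - 1)))" for \<theta>
  have f': "ereal (f' \<theta>) = max (f \<theta>) (ereal (g \<theta> - 1))" for \<theta>
    unfolding f'_def using le[of \<theta>] by (cases "f \<theta>") (auto simp: max_def)
  have f'_le: "f' \<theta> \<le> g \<theta>" "g \<theta> - 1 \<le> f' \<theta>" for \<theta>
  proof -
    have "max (f \<theta>) (ereal (g \<theta> - 1)) \<le> ereal (g \<theta>)" using le by simp
    then show "f' \<theta> \<le> g \<theta>" by (simp add: f'[symmetric])
    have "ereal (g \<theta> - 1) \<le> max (f \<theta>) (ereal (g \<theta> - 1))" by simp
    then show "g \<theta> - 1 \<le> f' \<theta>" by (simp add: f'[symmetric])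
  qed
  have gm: "g \<in> borel_measurable borel"
    by (rule borel_measurable_continuous_onI[OF g])
  have f'm: "f' \<in> borel_measurable circ"
    unfolding f'_def using f gm by measurable
  have gi: "integrable circ g" by (rule integral_circ[OF g])
  interpret finite_measure circ by (rule finite_measure_circ)
  have di: "integrable circ (\<lambda>\<theta>. g \<theta> - f' \<theta>)"
    using f'm gm f'_le by (intro integrable_const_bound[of _ 1]) (auto simp: abs_le_iff diff_le_eq add.commute)
  have f'i: "integrable circ f'"
    using Bochner_Integration.integrable_diff[OF gi di] by simp
  have "integral\<^sup>L circ (\<lambda>\<theta>. g \<theta> - f' \<theta>) \<noteq> 0"
  proof
    assume "integral\<^sup>L circ (\<lambda>\<theta>. g \<theta> - f' \<theta>) = 0"
    then have "AE \<theta> in circ. g \<theta> - f' \<theta> = 0"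
      using f'_le by (subst (asm) integral_nonneg_eq_0_iff_AE[OF di]) auto
    then have "AE \<theta> in lborel. \<theta> \<notin> {pi<..<2 * pi}"
      unfolding AE_circ
    proof (rule AE_mp, intro AE_I2 impI notI)
      fix \<theta> assume *: "\<theta> \<in> {0..2 * pi} \<longrightarrow> g \<theta> - f' \<theta> = 0" "\<theta> \<in> {pi<..<2 * pi}"
      then have "max (f \<theta>) (ereal (g \<theta> - 1)) = ereal (g \<theta>)"
        using f'[of \<theta>] by auto
      then show False using less[OF *(2)] by (auto simp: max_def split: if_splits)
    qed
    then have "emeasure lborel {pi<..<2 * pi} = 0"
      by (subst (asm) AE_iff_measurable[of "{pi<..<2 * pi}"]) auto
    then show False by simp
  qed
  moreover have "integral\<^sup>L circ (\<lambda>\<theta>. g \<theta> - f' \<theta>) \<ge> 0"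
    using f'_le by (intro Bochner_Integration.integral_nonneg) auto
  ultimately have "integral\<^sup>L circ f' < integral\<^sup>L circ g"
    using gi f'i by simp
  moreover have "ereal_integral circ f \<le> ereal (integral\<^sup>L circ f')"
    unfolding ereal_integral_real[OF f'i, symmetric] by (rule ereal_integral_mono) (simp add: f')
  ultimately show ?thesis
    by (metis ereal_less(2) less_ereal.simps(1) order.strict_trans1)
qed

text \<open>
  The mean value property of \<open>log \<bar>\<alpha> + \<zeta> \<beta>\<bar>\<close>, the real part of a holomorphic logarithm on a
  neighbourhood of the closed unit disc.
\<close>

lemma log_mean_inside:
  fixes \<alpha> \<beta> :: complex
  assumes "cmod \<beta> < cmod \<alpha>"
  shows "integral\<^sup>L circ (\<lambda>\<theta>. ln (cmod (\<alpha> + cis \<theta> * \<beta>))) = ln (cmod \<alpha>)"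
proof -
  define b where "b = \<beta> / \<alpha>"
  have a0: "\<alpha> \<noteq> 0" using assms by auto
  have b: "cmod b < 1" using assms a0 by (simp add: b_def norm_divide)
  have pos: "0 < Re (1 + b * z)" if "cmod z \<le> 1" for z
  proof -
    have "cmod (b * z) \<le> cmod b * 1"
      unfolding norm_mult using that by (intro mult_left_mono) auto
    then have "cmod (b * z) < 1" using b by linarith
    then show ?thesis using abs_Re_le_cmod[of "b * z"] by auto
  qed
  then have nz: "1 + b * z \<noteq> 0" if "cmod z \<le> 1" for z
    using that by (metis less_irrefl zero_complex.sel(1))
  have hol: "(\<lambda>z. Ln (1 + b * z)) holomorphic_on cball 0 1"
  proof (intro holomorphic_intros)
    fix z :: complex assume "z \<in> cball 0 1"
    then show "1 + b * z \<notin> \<real>\<^sub>\<le>\<^sub>0"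
      using pos[of z] unfolding complex_nonpos_Reals_iff by (auto simp del: plus_complex.sel)
  qed
  have "((\<lambda>u. Ln (1 + b * u) / (u - 0)) has_contour_integral
      2 * of_real pi * \<i> * Ln (1 + b * 0)) (circlepath 0 1)"
    by (rule Cauchy_integral_circlepath_simple[OF hol]) simp
  then have "((\<lambda>t. Ln (1 + b * cis t) / cis t * \<i> * cis t) has_integral 0) {0..2 * pi}"
    by (simp add: circlepath_def has_contour_integral_part_circlepath_iff)
  then have "((\<lambda>t. - \<i> * (Ln (1 + b * cis t) / cis t * \<i> * cis t)) has_integral - \<i> * 0) {0..2 * pi}"
    by (rule has_integral_mult_right)
  then have "((\<lambda>t. Ln (1 + b * cis t)) has_integral 0) {0..2 * pi}"
    by (simp add: field_simps)
  then have "((Re \<circ> (\<lambda>t. Ln (1 + b * cis t))) has_integral Re 0) {0..2 * pi}"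
    by (rule has_integral_linear) (rule bounded_linear_Re)
  then have I: "integral {0..2 * pi} (\<lambda>t. ln (cmod (1 + b * cis t))) = 0"
    using nz by (intro integral_unique) (auto simp: o_def)
  have c: "continuous_on UNIV (\<lambda>t. ln (cmod (1 + b * cis t)))"
    using nz by (auto intro!: continuous_intros simp: continuous_on_cis)
  have e: "ln (cmod (\<alpha> + cis t * \<beta>)) = ln (cmod \<alpha>) + ln (cmod (1 + b * cis t))" for t
  proof -
    have "\<alpha> + cis t * \<beta> = \<alpha> * (1 + b * cis t)" using a0 by (simp add: b_def field_simps)
    then show ?thesis using a0 nz[of "cis t"] by (simp add: norm_mult ln_mult)
  qed
  interpret finite_measure circ by (rule finite_measure_circ)
  show ?thesis
    unfolding e using integral_circ[OF c] I by (simp add: circ_prob)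
qed

lemma circ_integral_mono:
  fixes f g :: "real \<Rightarrow> real"
  assumes "continuous_on UNIV f" "continuous_on UNIV g" "\<And>\<theta>. f \<theta> \<le> g \<theta>"
  shows "integral\<^sup>L circ f \<le> integral\<^sup>L circ g"
  using assms by (intro integral_mono integral_circ)

text \<open>
  If the affine function has its zero inside the unit disc, then reflecting in the circle exchanges the roles
  of \<open>\<alpha>\<close> and \<open>\<beta>\<close>, and the mean is \<open>log \<bar>\<beta>\<bar>\<close>, which is larger.
\<close>

lemma log_mean_ge:
  fixes \<alpha> \<beta> :: complex
  assumes "\<alpha> \<noteq> 0" "cmod \<beta> \<noteq> cmod \<alpha>"
  shows "ln (cmod \<alpha>) \<le> integral\<^sup>L circ (\<lambda>\<theta>. ln (cmod (\<alpha> + cis \<theta> * \<beta>)))"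
proof (cases "cmod \<beta> < cmod \<alpha>")
  case True
  then show ?thesis by (simp add: log_mean_inside)
next
  case False
  then have *: "cmod (cnj \<alpha>) < cmod (cnj \<beta>)" using assms by simp
  have "cmod (\<alpha> + cis \<theta> * \<beta>) = cmod (cnj \<beta> + cis \<theta> * cnj \<alpha>)" for \<theta>
  proof -
    have "\<alpha> + cis \<theta> * \<beta> = cis \<theta> * cnj (cnj \<beta> + cis \<theta> * cnj \<alpha>)"
    proof -
      have 1: "cis \<theta> * cis (- \<theta>) = 1" by (simp add: cis_mult)
      have "cis \<theta> * cnj (cnj \<beta> + cis \<theta> * cnj \<alpha>) = cis \<theta> * \<beta> + (cis \<theta> * cis (- \<theta>)) * \<alpha>"
        by (simp only: complex_cnj_add complex_cnj_mult complex_cnj_cnj cis_cnj distrib_left mult.assoc)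
      then show ?thesis by (simp add: 1)
    qed
    then show ?thesis by (simp only: norm_mult norm_cis complex_mod_cnj mult_1)
  qed
  then have "integral\<^sup>L circ (\<lambda>\<theta>. ln (cmod (\<alpha> + cis \<theta> * \<beta>))) = ln (cmod \<beta>)"
    using log_mean_inside[OF *] by simp
  also have "ln (cmod \<alpha>) \<le> \<dots>" using False assms by (intro ln_mono) auto
  finally show ?thesis .
qed

text \<open>
  A function that dominates the modulus of an affine function, with equality at the centre, inherits the
  sub-mean value inequality for its logarithm. When the zero of the affine function lies on the unit circle,
  the inequality is proved on slightly smaller circles first; since \<open>log v\<close> is bounded and continuous, the
  means converge.
\<close>

lemma log_mean_ge_dominating:
  fixes v :: "complex \<Rightarrow> real"
  assumes v: "continuous_on (cball 0 1) v" "\<And>\<zeta>. \<zeta> \<in> cball 0 1 \<Longrightarrow> 0 < v \<zeta>"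
    and le: "\<And>\<zeta>. \<zeta> \<in> cball 0 1 \<Longrightarrow> cmod (\<alpha> + \<zeta> * \<beta>) \<le> v \<zeta>"
    and eq: "v 0 = cmod \<alpha>"
  shows "ln (v 0) \<le> integral\<^sup>L circ (\<lambda>\<theta>. ln (v (cis \<theta>)))"
proof -
  have contl: "continuous_on (cball 0 1) (\<lambda>\<zeta>. ln (v \<zeta>))"
    by (intro continuous_intros v(1) ballI less_imp_neq[OF v(2), symmetric])
  have inD: "of_real r * cis \<theta> \<in> cball 0 1" if "0 \<le> r" "r \<le> 1" for r \<theta>
    using that by (simp add: norm_mult)
  have cont: "continuous_on UNIV (\<lambda>\<theta>. ln (v (of_real r * cis \<theta>)))" if "0 \<le> r" "r \<le> 1" for r
    using inD[OF that] by (intro continuous_on_compose2[OF contl] continuous_intros)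
      (auto simp: continuous_on_cis)
  have a0: "\<alpha> \<noteq> 0" using v(2)[of 0] eq by auto
  have *: "ln (v 0) \<le> integral\<^sup>L circ (\<lambda>\<theta>. ln (v (of_real r * cis \<theta>)))"
    if r: "0 \<le> r" "r \<le> 1" "r * cmod \<beta> \<noteq> cmod \<alpha>" for r
  proof -
    have c: "cmod (of_real r * \<beta>) \<noteq> cmod \<alpha>" using r by (simp add: norm_mult)
    have nz: "\<alpha> + cis \<theta> * (of_real r * \<beta>) \<noteq> 0" for \<theta>
    proof
      assume "\<alpha> + cis \<theta> * (of_real r * \<beta>) = 0"
      then have "\<alpha> = - (cis \<theta> * (of_real r * \<beta>))" by (simp add: eq_neg_iff_add_eq_0)
      then have "cmod \<alpha> = cmod (of_real r * \<beta>)" by (simp add: norm_mult)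
      with c show False by simp
    qed
    have "ln (v 0) \<le> integral\<^sup>L circ (\<lambda>\<theta>. ln (cmod (\<alpha> + cis \<theta> * (of_real r * \<beta>))))"
      unfolding eq by (rule log_mean_ge[OF a0 c])
    also have "\<dots> \<le> integral\<^sup>L circ (\<lambda>\<theta>. ln (v (of_real r * cis \<theta>)))"
    proof (rule circ_integral_mono)
      show "continuous_on UNIV (\<lambda>\<theta>. ln (cmod (\<alpha> + cis \<theta> * (of_real r * \<beta>))))"
        using nz by (intro continuous_intros) (auto simp: continuous_on_cis)
      show "continuous_on UNIV (\<lambda>\<theta>. ln (v (of_real r * cis \<theta>)))" by (rule cont[OF r(1,2)])
      fix \<theta>
      show "ln (cmod (\<alpha> + cis \<theta> * (of_real r * \<beta>))) \<le> ln (v (of_real r * cis \<theta>))"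
        using nz[of \<theta>] le[OF inD[OF r(1,2)], of \<theta>] by (intro ln_mono) (auto simp: mult_ac)
    qed
    finally show ?thesis .
  qed
  show ?thesis
  proof (cases "cmod \<beta> = cmod \<alpha>")
    case False
    then show ?thesis using *[of 1] by simp
  next
    case True
    define r where "r n = 1 - 1 / (real n + 2)" for n
    have r: "0 \<le> r n" "r n \<le> 1" "r n * cmod \<beta> \<noteq> cmod \<alpha>" for n
      using a0 by (auto simp: r_def True field_simps)
    have rlim: "r \<longlonglongrightarrow> 1" unfolding r_def by real_asymp
    have "bounded ((\<lambda>\<zeta>. ln (v \<zeta>)) ` cball 0 1)"
      using contl by (intro compact_imp_bounded compact_continuous_image) auto
    then obtain B where B: "\<And>\<zeta>. \<zeta> \<in> cball 0 1 \<Longrightarrow> \<bar>ln (v \<zeta>)\<bar> \<le> B"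
      unfolding bounded_iff by fastforce
    have "(\<lambda>n. integral\<^sup>L circ (\<lambda>\<theta>. ln (v (of_real (r n) * cis \<theta>))))
        \<longlonglongrightarrow> integral\<^sup>L circ (\<lambda>\<theta>. ln (v (of_real 1 * cis \<theta>)))"
    proof (rule integral_dominated_convergence[where w = "\<lambda>_. B"])
      show "integrable circ (\<lambda>_. B)" by (rule integral_circ) simp
      show "(\<lambda>\<theta>. ln (v (of_real 1 * cis \<theta>))) \<in> borel_measurable circ"
        using integral_circ(1)[OF cont[of 1]] by (intro borel_measurable_integrable) simp
      show "(\<lambda>\<theta>. ln (v (of_real (r n) * cis \<theta>))) \<in> borel_measurable circ" for n
        using integral_circ(1)[OF cont[of "r n"]] r by (intro borel_measurable_integrable) simp
      show "AE \<theta> in circ. norm (ln (v (of_real (r n) * cis \<theta>))) \<le> B" for n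
        using B inD r by (intro AE_I2) simp
      show "AE \<theta> in circ. (\<lambda>n. ln (v (of_real (r n) * cis \<theta>))) \<longlonglongrightarrow> ln (v (of_real 1 * cis \<theta>))"
      proof (rule AE_I2)
        fix \<theta>
        show "(\<lambda>n. ln (v (of_real (r n) * cis \<theta>))) \<longlonglongrightarrow> ln (v (of_real 1 * cis \<theta>))"
          using inD r by (intro continuous_on_tendsto_compose[OF contl] tendsto_intros rlim) auto
      qed
    qed
    then have "(\<lambda>n. integral\<^sup>L circ (\<lambda>\<theta>. ln (v (of_real (r n) * cis \<theta>))))
        \<longlonglongrightarrow> integral\<^sup>L circ (\<lambda>\<theta>. ln (v (cis \<theta>)))" by simp
    then show ?thesis
      by (rule LIMSEQ_le_const) (use *[OF r] in blast)
  qed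
qed

section \<open>Subharmonic functions on the upper half plane\<close>

text \<open>
  Otherwise the sets \<open>{x \<in> S. f x < f y}\<close> with \<open>y \<in> S\<close> would cover \<open>S\<close>, and the largest of the finitely many
  \<open>f y\<close> of a finite subcover would be smaller than another one.
\<close>

lemma usc_attains_max:
  fixes f :: "'a::topological_space \<Rightarrow> 'b::linorder"
  assumes "compact S" "S \<noteq> {}" and usc: "\<And>c. openin (top_of_set S) {x \<in> S. f x < c}"
  obtains x where "x \<in> S" "\<And>y. y \<in> S \<Longrightarrow> f y \<le> f x"
proof (rule ccontr)
  assume "\<not> thesis"
  with that have no: "\<exists>y\<in>S. f x < f y" if "x \<in> S" for x
    using that by (meson not_le)
  have "\<exists>U. open U \<and> {x \<in> S. f x < c} = S \<inter> U" for c
    using usc[of c] by (simp add: openin_open)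
  then obtain U where U: "open (U c)" "{x \<in> S. f x < c} = S \<inter> U c" for c
    by metis
  have "S \<subseteq> (\<Union>y\<in>S. U (f y))"
    using no U(2) by blast
  then obtain T where T: "T \<subseteq> S" "finite T" "S \<subseteq> (\<Union>y\<in>T. U (f y))"
    using compactE_image[OF \<open>compact S\<close>, of S "\<lambda>y. U (f y)"] U(1) by metis
  with \<open>S \<noteq> {}\<close> have "T \<noteq> {}" by auto
  then obtain m where m: "m \<in> T" "\<And>y. y \<in> T \<Longrightarrow> f y \<le> f m"
  proof -
    have "Max (f ` T) \<in> f ` T" using \<open>finite T\<close> \<open>T \<noteq> {}\<close> by simp
    then obtain m where "m \<in> T" "f m = Max (f ` T)" by auto
    then show ?thesis using that \<open>finite T\<close> by simp
  qed
  then obtain y where "y \<in> T" "m \<in> U (f y)"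
    using T by blast
  then have "f m < f y" using U(2)[of "f y"] m(1) T(1) by blast
  with m(2)[OF \<open>y \<in> T\<close>] show False by simp
qed

lemma usc_on_subset: "usc_on S f \<Longrightarrow> T \<subseteq> S \<Longrightarrow> usc_on T f"
  unfolding usc_on_def
proof
  fix c assume *: "\<forall>c. openin (top_of_set S) {x \<in> S. f x < c}" and "T \<subseteq> S"
  then have "{x \<in> T. f x < c} = T \<inter> {x \<in> S. f x < c}" by auto
  then show "openin (top_of_set T) {x \<in> T. f x < c}"
    using openin_subtopology_Int2[OF *[rule_format, of c], of T] \<open>T \<subseteq> S\<close>
    by (simp add: subtopology_subtopology Int_absorb1)
qed

lemma usc_on_UNIV: "usc_on UNIV f \<longleftrightarrow> (\<forall>c. open {x. f x < c})"
  by (simp add: usc_on_def)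

lemma usc_on_minus_continuous:
  fixes f :: "'a::topological_space \<Rightarrow> ereal" and h :: "'a \<Rightarrow> real"
  assumes f: "usc_on S f" "\<And>x. x \<in> S \<Longrightarrow> f x < \<infinity>" and h: "continuous_on S h"
  shows "usc_on S (\<lambda>x. f x - ereal (h x))"
  unfolding usc_on_def
proof
  fix c :: ereal
  show "openin (top_of_set S) {x \<in> S. f x - ereal (h x) < c}"
  proof (cases c)
    case (real c)
    have iff: "f x - ereal (h x) < ereal c \<longleftrightarrow> (\<exists>q. f x < ereal q \<and> q - h x < c)" for x
    proof
      assume *: "f x - ereal (h x) < ereal c"
      show "\<exists>q. f x < ereal q \<and> q - h x < c"
      proof (cases "f x")
        case (real r)
        then show ?thesis
          using * by (intro exI[of _ "(r + (c + h x)) / 2"]) (auto simp: field_simps)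
      next
        case PInf
        then show ?thesis using * by simp
      next
        case MInf
        then show ?thesis by (intro exI[of _ "c + h x - 1"]) auto
      qed
    next
      assume "\<exists>q. f x < ereal q \<and> q - h x < c"
      then show "f x - ereal (h x) < ereal c" by (cases "f x") auto
    qed
    have "{x \<in> S. f x - ereal (h x) < ereal c} =
        (\<Union>q. {x \<in> S. f x < ereal q} \<inter> (S \<inter> (\<lambda>x. q - h x) -` {..<c}))"
      by (auto simp: iff)
    moreover have "openin (top_of_set S) (S \<inter> (\<lambda>x. q - h x) -` {..<c})" for q
      by (intro continuous_openin_preimage_gen continuous_intros h open_lessThan)
    moreover have "openin (top_of_set S) {x \<in> S. f x < ereal q}" for q
      using f(1) unfolding usc_on_def by blast
    ultimately have "openin (top_of_set S) {x \<in> S. f x - ereal (h x) < ereal c}"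
      by (simp only:) (intro openin_Union openin_Int ballI, auto)
    then show ?thesis using real by simp
  next
    case PInf
    have "f x - ereal (h x) < \<infinity>" if "x \<in> S" for x
      using f(2)[OF that] by (cases "f x") auto
    then have "{x \<in> S. f x - ereal (h x) < c} = S" using PInf by auto
    then show ?thesis by simp
  next
    case MInf
    then have "{x \<in> S. f x - ereal (h x) < c} = {}" by auto
    then show ?thesis by (simp only: openin_empty)
  qed
qed

lemma log_cmod_eventually_large:
  fixes \<epsilon> K :: real
  assumes "\<epsilon> > 0"
  obtains R where "\<And>\<zeta>. R < cmod \<zeta> \<Longrightarrow> K \<le> \<epsilon> * ln (cmod (\<zeta> + \<i>))"
proof
  fix \<zeta> :: complex assume "exp (K / \<epsilon>) + 1 < cmod \<zeta>"
  moreover have "cmod \<zeta> \<le> cmod (\<zeta> + \<i>) + 1"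
    using norm_triangle_ineq4[of "\<zeta> + \<i>" \<i>] by simp
  ultimately have *: "exp (K / \<epsilon>) < cmod (\<zeta> + \<i>)" by simp
  then have "K / \<epsilon> < ln (cmod (\<zeta> + \<i>))"
    using ln_less_cancel_iff[of "exp (K / \<epsilon>)" "cmod (\<zeta> + \<i>)"] less_trans[OF exp_gt_zero *] by simp
  then show "K \<le> \<epsilon> * ln (cmod (\<zeta> + \<i>))"
    using assms by (simp add: field_simps)
qed

text \<open>The function that is identically \<open>-\<infinity>\<close> counts as subharmonic.\<close>

definition subharmonic :: "(complex \<Rightarrow> ereal) \<Rightarrow> bool" where
  "subharmonic F \<longleftrightarrow> (\<forall>\<zeta>. F \<zeta> < \<infinity>) \<and> usc_on UNIV F \<and>
     (\<forall>c r. F c \<le> ereal_integral circ (\<lambda>\<theta>. F (c + cis \<theta> * r)))"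

text \<open>
  The term \<open>\<epsilon> log \<bar>\<zeta> + i\<bar>\<close> is nonnegative on the real axis and grows at infinity, so the difference
  \<open>G\<close> of the two sides can be positive only in a bounded part of the open half plane. If it is positive
  somewhere, it has a maximum; among the maximum points choose one that is closest to the real axis. The
  circle about it that touches the axis has its lower half outside the set of maximum points,
  which contradicts the sub-mean value inequality because the right-hand side is harmonic. This choice
  of the maximum point makes any connectedness argument superfluous.
\<close>

lemma phragmen_lindelof_eps:
  fixes F :: "complex \<Rightarrow> ereal"
  assumes F: "subharmonic F" and \<rho>: "Im \<rho> < 0" and \<epsilon>: "\<epsilon> > 0"
    and growth: "\<And>\<zeta>. Im \<zeta> \<ge> 0 \<Longrightarrow> F \<zeta> \<le> ereal (ln (cmod (\<zeta> - \<rho>)) + K)"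
    and bdry: "\<And>\<zeta>. Im \<zeta> = 0 \<Longrightarrow> F \<zeta> \<le> ereal (ln (cmod (\<zeta> - \<rho>)) + k)"
    and "Im \<zeta>1 \<ge> 0"
  shows "F \<zeta>1 \<le> ereal (ln (cmod (\<zeta>1 - \<rho>)) + k + \<epsilon> * ln (cmod (\<zeta>1 + \<i>)))"
proof (rule ccontr)
  define H where "H = {\<zeta>. Im \<zeta> \<ge> 0}"
  define h where "h \<zeta> = ln (cmod (\<zeta> - \<rho>)) + k + \<epsilon> * ln (cmod (\<zeta> + \<i>))" for \<zeta>
  define G where "G \<zeta> = F \<zeta> - ereal (h \<zeta>)" for \<zeta>
  assume "\<not> F \<zeta>1 \<le> ereal (ln (cmod (\<zeta>1 - \<rho>)) + k + \<epsilon> * ln (cmod (\<zeta>1 + \<i>)))"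
  then have 1: "ereal (h \<zeta>1) < F \<zeta>1" by (simp add: h_def)
  have Fle: "F \<zeta> \<le> ereal (x + h \<zeta>) \<longleftrightarrow> G \<zeta> \<le> ereal x" for \<zeta> x
    unfolding G_def by (cases "F \<zeta>") (auto simp: algebra_simps)
  have Flt: "F \<zeta> < ereal (x + h \<zeta>) \<longleftrightarrow> G \<zeta> < ereal x" for \<zeta> x
    unfolding G_def by (cases "F \<zeta>") (auto simp: algebra_simps)
  have Ffin: "F \<zeta> < \<infinity>" for \<zeta> using F by (simp add: subharmonic_def)
  have G1: "0 < G \<zeta>1" using 1 Fle[of \<zeta>1 0] by (auto simp: zero_ereal_def not_le[symmetric])
  have nz: "\<zeta> \<noteq> \<rho>" "\<zeta> + \<i> \<noteq> 0" "\<zeta> \<noteq> - \<i>" if "\<zeta> \<in> H" for \<zeta>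
    using that \<rho> by (auto simp: H_def complex_eq_iff)
  have contS: "continuous_on S h" if "S \<subseteq> H" for S
    unfolding h_def using nz that by (auto intro!: continuous_intros)
  have uscG: "usc_on S G" if "S \<subseteq> H" for S
    unfolding G_def using F contS[OF that]
    by (intro usc_on_minus_continuous) (auto simp: subharmonic_def intro: usc_on_subset)
  obtain R where R: "\<And>\<zeta>. R < cmod \<zeta> \<Longrightarrow> K - k \<le> \<epsilon> * ln (cmod (\<zeta> + \<i>))"
    using log_cmod_eventually_large[OF \<epsilon>, of "K - k"] by blast
  have far: "G \<zeta> \<le> 0" if "\<zeta> \<in> H" "R < cmod \<zeta>" for \<zeta>
  proof -
    have "F \<zeta> \<le> ereal (ln (cmod (\<zeta> - \<rho>)) + K)" using growth that by (simp add: H_def)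
    also have "\<dots> \<le> ereal (0 + h \<zeta>)" using R[OF that(2)] by (simp add: h_def)
    finally show ?thesis by (simp only: Fle zero_ereal_def)
  qed
  have near: "G \<zeta> \<le> 0" if "Im \<zeta> = 0" for \<zeta>
  proof -
    have "1 \<le> cmod (\<zeta> + \<i>)" using abs_Im_le_cmod[of "\<zeta> + \<i>"] that by simp
    then have "0 \<le> \<epsilon> * ln (cmod (\<zeta> + \<i>))" using \<epsilon> by simp
    with bdry[OF that] have "F \<zeta> \<le> ereal (0 + h \<zeta>)"
      unfolding h_def by (elim order_trans) simp
    then show ?thesis by (simp only: Fle zero_ereal_def)
  qed
  define T where "T = H \<inter> cball 0 R"
  have "closed H" unfolding H_def by (intro closed_Collect_le continuous_intros)
  then have T: "compact T" "T \<subseteq> H" unfolding T_def by (auto intro: closed_Int_compact)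
  have "\<zeta>1 \<in> T" using far[of \<zeta>1] G1 \<open>Im \<zeta>1 \<ge> 0\<close> unfolding T_def H_def
    by (auto simp: not_less[symmetric])
  obtain \<zeta>m where \<zeta>m: "\<zeta>m \<in> T" "\<And>\<zeta>. \<zeta> \<in> T \<Longrightarrow> G \<zeta> \<le> G \<zeta>m"
    using usc_attains_max[of T G] T \<open>\<zeta>1 \<in> T\<close> uscG[OF T(2)] unfolding usc_on_def by blast
  have pos: "0 < G \<zeta>m" using \<zeta>m(2)[OF \<open>\<zeta>1 \<in> T\<close>] G1 by simp
  moreover have "G \<zeta>m < \<infinity>" unfolding G_def using Ffin[of \<zeta>m] by (cases "F \<zeta>m") auto
  ultimately obtain M where M: "G \<zeta>m = ereal M" by (cases "G \<zeta>m") auto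
  have M0: "0 < M" using pos M by simp
  have max: "G \<zeta> \<le> ereal M" if "\<zeta> \<in> H" for \<zeta>
    using far[OF that] \<zeta>m(2)[of \<zeta>] that M pos unfolding T_def
    by (cases "R < cmod \<zeta>") (auto intro: order_trans)
  define S where "S = {\<zeta> \<in> T. \<not> G \<zeta> < ereal M}"
  have "closedin (top_of_set T) S"
  proof -
    have "S = T - {\<zeta> \<in> T. G \<zeta> < ereal M}" by (auto simp: S_def)
    then show ?thesis using uscG[OF T(2)] by (simp add: usc_on_def closedin_diff)
  qed
  then have "compact S" using T(1) closedin_compact by blast
  moreover have "\<zeta>m \<in> S" using \<zeta>m M by (simp add: S_def)
  ultimately obtain c where c: "c \<in> S" "\<And>\<zeta>. \<zeta> \<in> S \<Longrightarrow> Im c \<le> Im \<zeta>"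
    using continuous_attains_inf[of S Im] continuous_on_Im[OF continuous_on_id, of S] by auto
  have cH: "c \<in> H" and cG: "G c = ereal M"
    using c(1) max[of c] by (auto simp: S_def T_def)
  have "Im c \<noteq> 0" using near[of c] cG M0 by auto
  then have Imc: "0 < Im c" using cH by (simp add: H_def)
  let ?r = "complex_of_real (Im c)"
  have inH: "c + cis \<theta> * ?r \<in> H" for \<theta>
  proof -
    have "Im c * - 1 \<le> Im c * sin \<theta>" using Imc by (intro mult_left_mono) auto
    then show ?thesis by (simp add: H_def mult.commute)
  qed
  have "ereal_integral circ (\<lambda>\<theta>. F (c + cis \<theta> * ?r))
      < ereal (integral\<^sup>L circ (\<lambda>\<theta>. M + h (c + cis \<theta> * ?r)))"
  proof (rule ereal_integral_circ_less)
    show "continuous_on UNIV (\<lambda>\<theta>. M + h (c + cis \<theta> * ?r))"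
      using inH by (intro continuous_intros continuous_on_compose2[OF contS[OF order_refl]])
        (auto simp: continuous_on_cis)
    show "(\<lambda>\<theta>. F (c + cis \<theta> * ?r)) \<in> borel_measurable borel"
    proof (rule borel_measurableI_less)
      fix y
      have "open {\<zeta>. F \<zeta> < y}" using F by (simp add: subharmonic_def usc_on_UNIV)
      then have "open ((\<lambda>\<theta>. c + cis \<theta> * ?r) -` {\<zeta>. F \<zeta> < y})"
        by (intro open_vimage continuous_intros) (auto simp: continuous_on_cis)
      then show "{x \<in> space borel. F (c + cis x * ?r) < y} \<in> sets borel"
        by (simp add: vimage_def)
    qed
    fix \<theta> :: real
    show "F (c + cis \<theta> * ?r) \<le> ereal (M + h (c + cis \<theta> * ?r))"
      unfolding Fle by (rule max[OF inH])
    assume \<theta>: "\<theta> \<in> {pi<..<2 * pi}"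
    then have "sin \<theta> < 0" by (intro sin_lt_zero) auto
    then have "Im (c + cis \<theta> * ?r) < Im c" using Imc by (simp add: mult_neg_pos)
    then have "c + cis \<theta> * ?r \<notin> S" using c(2) by force
    moreover have "G (c + cis \<theta> * ?r) < ereal M" if "c + cis \<theta> * ?r \<notin> T"
    proof -
      have "G (c + cis \<theta> * ?r) \<le> 0"
        using that inH[of \<theta>] by (intro far) (auto simp: T_def)
      also have "0 < ereal M" using M0 by simp
      finally show ?thesis .
    qed
    ultimately show "F (c + cis \<theta> * ?r) < ereal (M + h (c + cis \<theta> * ?r))"
      unfolding Flt S_def by auto
  qed
  also have "integral\<^sup>L circ (\<lambda>\<theta>. M + h (c + cis \<theta> * ?r)) = M + h c"
  proof -
    have r\<rho>: "cmod ?r < cmod (c - \<rho>)"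
      using abs_Im_le_cmod[of "c - \<rho>"] Imc \<rho> by simp
    have ri: "cmod ?r < cmod (c + \<i>)"
      using abs_Im_le_cmod[of "c + \<i>"] Imc by simp
    have e: "c + cis \<theta> * ?r - \<rho> = (c - \<rho>) + cis \<theta> * ?r"
      "c + cis \<theta> * ?r + \<i> = (c + \<i>) + cis \<theta> * ?r" for \<theta> by auto
    have "integrable circ (\<lambda>\<theta>. ln (cmod ((c - \<rho>) + cis \<theta> * ?r)))"
      "integrable circ (\<lambda>\<theta>. ln (cmod ((c + \<i>) + cis \<theta> * ?r)))"
      using nz[OF inH] unfolding e[symmetric]
      by (auto intro!: integral_circ continuous_intros simp: continuous_on_cis)
    moreover have "integrable circ (\<lambda>_. x :: real)" for x
      by (rule integral_circ) simp
    ultimately show ?thesis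
      unfolding h_def e by (simp add: log_mean_inside[OF r\<rho>] log_mean_inside[OF ri] circ_prob)
  qed
  also have "ereal (M + h c) = F c"
    using cG unfolding G_def by (cases "F c") auto
  finally have "ereal_integral circ (\<lambda>\<theta>. F (c + cis \<theta> * ?r)) < F c" .
  moreover have "F c \<le> ereal_integral circ (\<lambda>\<theta>. F (c + cis \<theta> * ?r))"
    using F unfolding subharmonic_def by blast
  ultimately show False by simp
qed

lemma phragmen_lindelof:
  fixes F :: "complex \<Rightarrow> ereal"
  assumes F: "subharmonic F" and \<rho>: "Im \<rho> < 0"
    and growth: "\<And>\<zeta>. Im \<zeta> \<ge> 0 \<Longrightarrow> F \<zeta> \<le> ereal (ln (cmod (\<zeta> - \<rho>)) + K)"
    and bdry: "\<And>\<zeta>. Im \<zeta> = 0 \<Longrightarrow> F \<zeta> \<le> ereal (ln (cmod (\<zeta> - \<rho>)) + k)"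
    and "Im \<zeta> \<ge> 0"
  shows "F \<zeta> \<le> ereal (ln (cmod (\<zeta> - \<rho>)) + k)"
proof (rule tendsto_lowerbound)
  let ?l = "\<lambda>\<epsilon>. ereal (ln (cmod (\<zeta> - \<rho>)) + k + \<epsilon> * ln (cmod (\<zeta> + \<i>)))"
  have "(?l \<longlongrightarrow> ereal (ln (cmod (\<zeta> - \<rho>)) + k + 0 * ln (cmod (\<zeta> + \<i>)))) (at_right 0)"
    by (intro tendsto_intros)
  then show "(?l \<longlongrightarrow> ereal (ln (cmod (\<zeta> - \<rho>)) + k)) (at_right 0)" by simp
  show "\<forall>\<^sub>F \<epsilon> in at_right 0. F \<zeta> \<le> ?l \<epsilon>"
    using eventually_at_right_less[of 0]
    by eventually_elim (rule phragmen_lindelof_eps[OF assms(1,2) _ assms(3-5)])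
  show "at_right (0::real) \<noteq> bot" by simp
qed

section \<open>Homogeneous coordinates and charts\<close>

lemma norm_sq_vec: "(norm Z)\<^sup>2 = (\<Sum>i\<in>UNIV. (cmod (Z $ i))\<^sup>2)" for Z :: "complex ^ 'm::finite"
  by (simp add: norm_vec_def L2_set_def sum_nonneg)

lemma norm_scale: "norm (c *s Z) = cmod c * norm Z" for Z :: "complex ^ 'm::finite"
  by (simp add: norm_vec_def norm_mult L2_set_right_distrib)

lemma cproj_cases:
  obtains Z where "Z \<noteq> 0" "x = hom_point Z"
proof
  show "cproj_rep x \<noteq> 0"
    using Quotient3_rep_reflp[OF Quotient3_cproj, of x] by (simp add: proportional_def)
  show "x = hom_point (cproj_rep x)"
    by (rule Quotient3_abs_rep[OF Quotient3_cproj, symmetric])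
qed

lemma open_cproj_iff:
  "open U \<longleftrightarrow> open {Z. Z \<noteq> 0 \<and> hom_point Z \<in> U}"
  by (simp only: open_cproj_def)

lemma continuous_on_hom_point: "continuous_on (- {0}) hom_point"
proof -
  have "open (hom_point -` U \<inter> - {0})" if "open U" for U :: "'a cproj set"
  proof -
    have "hom_point -` U \<inter> - {0} = {Z. Z \<noteq> 0 \<and> hom_point Z \<in> U}" by auto
    then show ?thesis using that by (simp add: open_cproj_iff)
  qed
  then show ?thesis by (subst continuous_on_open_vimage) auto
qed

lemma continuous_on_cproj:
  fixes f :: "('n::finite) cproj \<Rightarrow> 'a::topological_space"
  assumes "continuous_on (- {0}) (\<lambda>Z. f (hom_point Z))"
  shows "continuous_on UNIV f"
proof -
  have "open (f -` U)" if "open U" for U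
  proof -
    have "open ((\<lambda>Z. f (hom_point Z)) -` U \<inter> - {0})"
      using assms that by (subst (asm) continuous_on_open_vimage) auto
    also have "(\<lambda>Z. f (hom_point Z)) -` U \<inter> - {0} = {Z. Z \<noteq> 0 \<and> hom_point Z \<in> f -` U}" by auto
    finally show ?thesis by (simp only: open_cproj_iff)
  qed
  then show ?thesis by (simp add: continuous_on_open_vimage)
qed

lemma compact_cproj: "compact (UNIV :: ('n::finite) cproj set)"
proof -
  have "x \<in> hom_point ` sphere 0 1" for x :: "'n cproj"
  proof -
    obtain Z where Z: "Z \<noteq> 0" "x = hom_point Z" by (rule cproj_cases)
    let ?c = "complex_of_real (inverse (norm Z))"
    have "norm (?c *s Z) = 1" using Z(1) by (simp only: norm_scale norm_of_real) simp
    moreover from this have "hom_point Z = hom_point (?c *s Z)"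
      using Z(1) by (subst hom_point_eq_iff) (auto intro!: exI[of _ ?c])
    ultimately show ?thesis using Z(2) by (intro image_eqI[of _ _ "?c *s Z"]) simp_all
  qed
  then have "UNIV = hom_point ` sphere (0 :: complex ^ 'n option) 1" by blast
  moreover have "compact (hom_point ` sphere (0 :: complex ^ 'n option) 1)"
    by (intro compact_continuous_image continuous_on_subset[OF continuous_on_hom_point]) auto
  ultimately show ?thesis by simp
qed

definition chart_lift :: "'n option \<Rightarrow> complex ^ 'n \<Rightarrow> complex ^ ('n::finite) option" where
  "chart_lift j z = (\<chi> i. affine_lift z $ Transposition.transpose None j i)"

lemma affine_chart_lift: "affine_chart j z = hom_point (chart_lift j z)"
  by (simp add: affine_chart_def chart_lift_def)

lemma chart_lift_nonzero: "chart_lift j z \<noteq> 0"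
  using affine_chart_lift_nonzero by (simp add: chart_lift_def)

lemma chart_lift_affine:
  "chart_lift j (a + \<zeta> *s b) = chart_lift j a + \<zeta> *s (chart_lift j b - chart_lift j 0)"
  by (auto simp: vec_eq_iff chart_lift_def affine_lift_def split: option.splits)

lemma sum_option: "(\<Sum>i\<in>UNIV. f i) = f None + (\<Sum>k\<in>UNIV. f (Some k))"
  for f :: "'n::finite option \<Rightarrow> 'b::comm_monoid_add"
  by (simp add: UNIV_option_conv sum.reindex)

lemma norm_chart_lift: "(norm (chart_lift j z))\<^sup>2 = 1 + (norm z)\<^sup>2"
proof -
  have "(norm (chart_lift j z))\<^sup>2 =
      (\<Sum>i\<in>UNIV. (cmod (affine_lift z $ Transposition.transpose None j i))\<^sup>2)"
    by (simp add: norm_sq_vec chart_lift_def)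
  also have "\<dots> = (\<Sum>i\<in>UNIV. (cmod (affine_lift z $ i))\<^sup>2)"
    by (rule sum.reindex_bij_betw[of "Transposition.transpose None j" UNIV UNIV
          "\<lambda>i. (cmod (affine_lift z $ i))\<^sup>2"]) simp
  also have "\<dots> = 1 + (norm z)\<^sup>2"
    by (simp add: sum_option affine_lift_def norm_sq_vec)
  finally show ?thesis .
qed

lemma u0_chart_lift: "u0 z = ln (norm (chart_lift j z))"
proof -
  have "ln ((norm (chart_lift j z))\<^sup>2) = 2 * ln (norm (chart_lift j z))"
    using chart_lift_nonzero[of j z] by (subst ln_realpow) auto
  then show ?thesis by (simp add: u0_def norm_chart_lift)
qed

lemma continuous_chart_lift: "continuous_on S (chart_lift j)"
proof -
  have *: "continuous_on S (\<lambda>z :: complex ^ 'a. affine_lift z $ i)" for i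
    by (cases i) (auto simp: affine_lift_def intro!: continuous_intros)
  show ?thesis unfolding chart_lift_def by (intro continuous_on_vec_lambda *)
qed

lemma cproj_chart_cases:
  fixes x :: "('n::finite) cproj"
  obtains j z where "x = affine_chart j z"
proof -
  obtain Z where Z: "Z \<noteq> 0" "x = hom_point Z" by (rule cproj_cases)
  then obtain j where j: "Z $ j \<noteq> 0" by (auto simp: vec_eq_iff)
  define z :: "complex ^ 'n" where "z = (\<chi> k. Z $ Transposition.transpose None j (Some k) / Z $ j)"
  have "affine_lift z $ i = Z $ Transposition.transpose None j i / Z $ j" for i
    using j by (cases i) (auto simp: affine_lift_def z_def)
  then have "chart_lift j z = inverse (Z $ j) *s Z"
    by (simp add: vec_eq_iff chart_lift_def field_simps)
  then have "hom_point Z = hom_point (chart_lift j z)"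
    using Z(1) j chart_lift_nonzero[of j z]
    by (subst hom_point_eq_iff) (auto intro!: exI[of _ "inverse (Z $ j)"])
  with Z(2) that show ?thesis by (simp add: affine_chart_lift)
qed

lemma affine_chart_real:
  assumes "\<And>k. z $ k \<in> \<real>"
  shows "affine_chart j z \<in> real_points"
proof -
  have "affine_lift z $ i \<in> \<real>" for i
    using assms by (cases i) (auto simp: affine_lift_def)
  then have "chart_lift j z $ i \<in> \<real>" for i by (simp add: chart_lift_def)
  then show ?thesis
    using chart_lift_nonzero[of j z] unfolding real_points_def affine_chart_lift by blast
qed

section \<open>The upper bound\<close>

lemma psh_on_line:
  assumes "psh_on UNIV w"
  shows "subharmonic (\<lambda>\<zeta>. w (a + \<zeta> *s b))"
  unfolding subharmonic_def
proof (intro conjI allI)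
  fix \<zeta> show "w (a + \<zeta> *s b) < \<infinity>" using assms by (simp add: psh_on_def)
next
  show "usc_on UNIV (\<lambda>\<zeta>. w (a + \<zeta> *s b))"
    unfolding usc_on_UNIV
  proof
    fix c
    have "open {z. w z < c}" using assms by (simp add: psh_on_def usc_on_UNIV)
    moreover have "continuous_on UNIV (\<lambda>\<zeta>. a + \<zeta> *s b)"
      unfolding vector_scalar_mult_def by (intro continuous_intros)
    ultimately have "open ((\<lambda>\<zeta>. a + \<zeta> *s b) -` {z. w z < c})" by (rule open_vimage)
    then show "open {\<zeta>. w (a + \<zeta> *s b) < c}" by (simp add: vimage_def)
  qed
next
  fix c r
  have "w (a + c *s b) \<le> ereal_integral circ (\<lambda>\<theta>. w ((a + c *s b) + cis \<theta> *s (r *s b)))"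
    using assms unfolding psh_on_def by blast
  moreover have "(a + c *s b) + cis \<theta> *s (r *s b) = a + (c + cis \<theta> * r) *s b" for \<theta>
    by (simp add: vec_eq_iff algebra_simps)
  ultimately show "w (a + c *s b) \<le> ereal_integral circ (\<lambda>\<theta>. w (a + (c + cis \<theta> * r) *s b))"
    by (simp only:)
qed

lemma usc_cproj_bounded:
  fixes \<phi> :: "('n::finite) cproj \<Rightarrow> ereal"
  assumes "usc_on UNIV \<phi>" "\<And>x. \<phi> x < \<infinity>"
  obtains C :: real where "\<And>x. \<phi> x \<le> ereal C"
proof -
  obtain m where m: "\<And>x. \<phi> x \<le> \<phi> m"
    by (rule usc_attains_max[OF compact_cproj, of \<phi>]) (use assms(1) in \<open>auto simp: usc_on_def\<close>)
  show ?thesis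
  proof (cases "\<phi> m")
    case (real C)
    then show ?thesis using m that[of C] by simp
  next
    case PInf
    with assms(2)[of m] show ?thesis by simp
  next
    case MInf
    then have "\<phi> x \<le> ereal 0" for x using order_trans[OF m[of x], of "ereal 0"] by simp
    then show ?thesis by (rule that)
  qed
qed

text \<open>
  With \<open>a\<close> and \<open>b\<close> the real and imaginary parts of the affine coordinates of the point, let
  \<open>\<alpha> = \<bar>a\<bar>\<^sup>2\<close>, \<open>\<beta> = a \<bullet> b\<close>, \<open>\<gamma> = \<bar>b\<bar>\<^sup>2\<close>. For \<open>\<zeta> = x + i y\<close>, completing the square gives
  \<open>1 + \<bar>a + \<zeta> b\<bar>\<^sup>2 = \<gamma> ((x + \<beta> / \<gamma>)\<^sup>2 + D\<^sup>2 + y\<^sup>2)\<close>, whereas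
  \<open>\<bar>\<zeta> - \<rho>\<bar>\<^sup>2 = (x + \<beta> / \<gamma>)\<^sup>2 + (y + D)\<^sup>2\<close> for \<open>\<rho> = - \<beta> / \<gamma> - i D\<close>. On the upper half plane the
  two quadratic expressions agree up to a factor between \<open>1\<close> and \<open>2\<close>, and the factor is \<open>1\<close> on the real axis.
  The inequality \<open>(y + D)\<^sup>2 \<le> 2 (y\<^sup>2 + D\<^sup>2)\<close> is the source of the constant \<open>(log 2) / 2\<close>.
\<close>

lemma competitor_le:
  fixes \<phi> :: "('n::finite) cproj \<Rightarrow> ereal"
  assumes "\<phi> \<in> PSH_omega" and real_le: "\<And>y. y \<in> real_points \<Longrightarrow> \<phi> y \<le> 0"
  shows "\<phi> x \<le> ereal (ln 2 / 2)"
proof -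
  obtain j z where x: "x = affine_chart j z" by (rule cproj_chart_cases)
  define p where "p k = Re (z $ k)" for k
  define q where "q k = Im (z $ k)" for k
  define a b :: "complex ^ 'n" where "a = (\<chi> k. of_real (p k))" and "b = (\<chi> k. of_real (q k))"
  have z: "z = a + \<i> *s b"
    by (simp add: vec_eq_iff a_def b_def p_def q_def complex_eq_iff)
  define \<alpha> \<beta> \<gamma> where "\<alpha> = (\<Sum>k\<in>UNIV. (p k)\<^sup>2)" and "\<beta> = (\<Sum>k\<in>UNIV. p k * q k)"
    and "\<gamma> = (\<Sum>k\<in>UNIV. (q k)\<^sup>2)"
  show ?thesis
  proof (cases "\<gamma> = 0")
    case True
    then have "q k = 0" for k unfolding \<gamma>_def by (simp add: sum_nonneg_eq_0_iff)
    then have "z $ k \<in> \<real>" for k by (simp add: q_def complex_is_Real_iff)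
    then have "\<phi> x \<le> 0" unfolding x by (intro real_le affine_chart_real)
    also have "0 \<le> ereal (ln 2 / 2)" by simp
    finally show ?thesis .
  next
    case False
    moreover have "0 \<le> \<gamma>" unfolding \<gamma>_def by (intro sum_nonneg) simp
    ultimately have \<gamma>: "0 < \<gamma>" by simp
    have disc: "0 < (1 + \<alpha>) * \<gamma> - \<beta>\<^sup>2"
    proof -
      have "\<beta>\<^sup>2 \<le> \<alpha> * \<gamma>" unfolding \<alpha>_def \<beta>_def \<gamma>_def by (rule Cauchy_Schwarz_ineq_sum)
      then show ?thesis using \<gamma> by (simp add: algebra_simps)
    qed
    define D where "D = sqrt ((1 + \<alpha>) * \<gamma> - \<beta>\<^sup>2) / \<gamma>"
    have D: "0 < D" using disc \<gamma> by (simp add: D_def)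
    have D2: "\<gamma> * D\<^sup>2 = 1 + \<alpha> - \<beta>\<^sup>2 / \<gamma>"
    proof -
      have "D\<^sup>2 = ((1 + \<alpha>) * \<gamma> - \<beta>\<^sup>2) / \<gamma>\<^sup>2"
        using disc unfolding D_def by (simp add: power_divide)
      then have "\<gamma> * D\<^sup>2 = ((1 + \<alpha>) * \<gamma> - \<beta>\<^sup>2) / \<gamma>"
        using \<gamma> by (simp add: power2_eq_square)
      then show ?thesis using \<gamma> by (simp add: diff_divide_distrib)
    qed
    define \<rho> where "\<rho> = Complex (- \<beta> / \<gamma>) (- D)"
    have \<rho>: "Im \<rho> < 0" using D by (simp add: \<rho>_def)
    define line where "line \<zeta> = a + \<zeta> *s b" for \<zeta>
    have norm_line: "1 + (norm (line \<zeta>))\<^sup>2 = \<gamma> * ((Re \<zeta> + \<beta> / \<gamma>)\<^sup>2 + D\<^sup>2 + (Im \<zeta>)\<^sup>2)" for \<zeta>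
    proof -
      have "(cmod (line \<zeta> $ k))\<^sup>2 = (p k)\<^sup>2 + 2 * Re \<zeta> * (p k * q k) + ((Re \<zeta>)\<^sup>2 + (Im \<zeta>)\<^sup>2) * (q k)\<^sup>2" for k
        by (simp add: line_def a_def b_def cmod_power2) (simp add: power2_eq_square algebra_simps)
      then have "(norm (line \<zeta>))\<^sup>2 = \<alpha> + 2 * Re \<zeta> * \<beta> + ((Re \<zeta>)\<^sup>2 + (Im \<zeta>)\<^sup>2) * \<gamma>"
        by (simp add: norm_sq_vec \<alpha>_def \<beta>_def \<gamma>_def sum.distrib sum_distrib_left)
      moreover have "\<gamma> * ((Re \<zeta> + \<beta> / \<gamma>)\<^sup>2 + D\<^sup>2 + (Im \<zeta>)\<^sup>2) =
          \<gamma> * (Re \<zeta> + \<beta> / \<gamma>)\<^sup>2 + \<gamma> * D\<^sup>2 + \<gamma> * (Im \<zeta>)\<^sup>2"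
        by (simp add: algebra_simps)
      moreover have "\<gamma> * (Re \<zeta> + \<beta> / \<gamma>)\<^sup>2 = \<gamma> * (Re \<zeta>)\<^sup>2 + 2 * Re \<zeta> * \<beta> + \<beta>\<^sup>2 / \<gamma>"
        using \<gamma> by (simp add: field_simps power2_eq_square)
      ultimately show ?thesis
        unfolding D2 by (simp add: algebra_simps)
    qed
    have norm_\<rho>: "(cmod (\<zeta> - \<rho>))\<^sup>2 = (Re \<zeta> + \<beta> / \<gamma>)\<^sup>2 + (Im \<zeta> + D)\<^sup>2" for \<zeta>
      by (simp add: cmod_power2 \<rho>_def)
    have h: "ln (cmod (\<zeta> - \<rho>)) + ln \<gamma> / 2 = ln (\<gamma> * ((Re \<zeta> + \<beta> / \<gamma>)\<^sup>2 + (Im \<zeta> + D)\<^sup>2)) / 2"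
      if "Im \<zeta> \<ge> 0" for \<zeta>
    proof -
      have "cmod (\<zeta> - \<rho>) > 0" using that \<rho> by auto
      then show ?thesis
        unfolding norm_\<rho>[symmetric] using \<gamma> by (simp add: ln_mult ln_realpow)
    qed
    define F where "F \<zeta> = ereal (u0 (line \<zeta>)) + \<phi> (affine_chart j (line \<zeta>))" for \<zeta>
    have sub: "subharmonic F"
      unfolding F_def line_def using assms(1)
      by (intro psh_on_line[of "\<lambda>z. ereal (u0 z) + \<phi> (affine_chart j z)"])
        (simp add: PSH_omega_def ddc_plus_omega_nonneg_def)
    obtain C where C: "\<And>x. \<phi> x \<le> ereal C"
      using usc_cproj_bounded[of \<phi>] assms(1) by (auto simp: PSH_omega_def)
    have u0_le: "u0 (line \<zeta>) \<le> ln (cmod (\<zeta> - \<rho>)) + ln \<gamma> / 2" if "Im \<zeta> \<ge> 0" for \<zeta>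
    proof -
      have "D\<^sup>2 + (Im \<zeta>)\<^sup>2 \<le> (Im \<zeta> + D)\<^sup>2" using that D by (simp add: power2_sum)
      moreover have "0 < (Re \<zeta> + \<beta> / \<gamma>)\<^sup>2 + D\<^sup>2 + (Im \<zeta>)\<^sup>2"
        using D by (intro add_pos_nonneg add_nonneg_pos) auto
      ultimately show ?thesis
        unfolding h[OF that] u0_def norm_line using \<gamma> by simp
    qed
    have "F \<i> \<le> ereal (ln (cmod (\<i> - \<rho>)) + ln \<gamma> / 2)"
    proof (rule phragmen_lindelof[OF sub \<rho>, where K = "ln \<gamma> / 2 + C"])
      fix \<zeta> assume "Im \<zeta> \<ge> 0"
      have "F \<zeta> \<le> ereal (u0 (line \<zeta>)) + ereal C"
        unfolding F_def by (intro add_left_mono C)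
      also have "\<dots> \<le> ereal (ln (cmod (\<zeta> - \<rho>)) + (ln \<gamma> / 2 + C))"
        using u0_le[OF \<open>Im \<zeta> \<ge> 0\<close>] by simp
      finally show "F \<zeta> \<le> ereal (ln (cmod (\<zeta> - \<rho>)) + (ln \<gamma> / 2 + C))" .
    next
      fix \<zeta> assume "Im \<zeta> = 0"
      then have "line \<zeta> $ k \<in> \<real>" for k
        by (simp add: line_def a_def b_def complex_is_Real_iff)
      then have "F \<zeta> \<le> ereal (u0 (line \<zeta>)) + 0"
        unfolding F_def by (intro add_left_mono real_le affine_chart_real)
      also have "\<dots> \<le> ereal (ln (cmod (\<zeta> - \<rho>)) + ln \<gamma> / 2)"
        using u0_le[of \<zeta>] \<open>Im \<zeta> = 0\<close> by simp
      finally show "F \<zeta> \<le> ereal (ln (cmod (\<zeta> - \<rho>)) + ln \<gamma> / 2)" .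
    qed simp
    also have "ln (cmod (\<i> - \<rho>)) + ln \<gamma> / 2 \<le> u0 (line \<i>) + ln 2 / 2"
    proof -
      have "0 \<le> (1 - D)\<^sup>2" by simp
      then have D1: "(1 + D)\<^sup>2 \<le> 2 * (D\<^sup>2 + 1)" by (simp add: power2_eq_square algebra_simps)
      have "x + s \<le> 2 * (x + t + 1)" if "0 \<le> x" "s \<le> 2 * (t + 1)" for x s t :: real
        using that by (simp add: algebra_simps)
      from this[OF zero_le_power2 D1]
      have le: "(\<beta> / \<gamma>)\<^sup>2 + (1 + D)\<^sup>2 \<le> 2 * ((\<beta> / \<gamma>)\<^sup>2 + D\<^sup>2 + 1)" .
      have pos: "0 < (\<beta> / \<gamma>)\<^sup>2 + (1 + D)\<^sup>2" "0 < (\<beta> / \<gamma>)\<^sup>2 + D\<^sup>2 + 1"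
        using D by (intro add_nonneg_pos; simp)+
      have "ln (\<gamma> * ((\<beta> / \<gamma>)\<^sup>2 + (1 + D)\<^sup>2)) \<le> ln (2 * (\<gamma> * ((\<beta> / \<gamma>)\<^sup>2 + D\<^sup>2 + 1)))"
        using \<gamma> le pos mult_left_mono[OF le, of \<gamma>] by (intro ln_mono) (auto simp: mult.left_commute)
      also have "\<dots> = ln 2 + ln (\<gamma> * ((\<beta> / \<gamma>)\<^sup>2 + D\<^sup>2 + 1))"
        using \<gamma> pos by (intro ln_mult_pos) auto
      finally show ?thesis
        using h[of \<i>] norm_line[of \<i>] by (simp add: u0_def)
    qed
    finally have "ereal (u0 z) + \<phi> x \<le> ereal (u0 z + ln 2 / 2)"
      by (simp add: F_def line_def z x)
    then show ?thesis by (cases "\<phi> x") auto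
  qed
qed

section \<open>Finiteness of the Fubini--Study volume\<close>

text \<open>
  The density is \<open>O(\<bar>z\<bar> ^ (- 2 n - 2))\<close> on a real space of dimension \<open>2 n\<close>. On the shell between the balls of radii
  \<open>2 ^ (m - 1)\<close> and \<open>2 ^ m\<close> it is at most \<open>U q\<^sup>1\<^sup>-\<^sup>m\<close> with \<open>q = 4 ^ (n + 1)\<close>, and the larger ball has volume
  proportional to \<open>4 ^ (n m)\<close>, so the shells contribute at most a geometric series of ratio \<open>1 / 4\<close>.
\<close>

lemma fs_measure_finite: "emeasure (fs_measure :: ('n::finite) cproj measure) UNIV < \<infinity>"
proof -
  define n where "n = CARD('n)"
  define q :: real where "q = 4 ^ (n + 1)"
  define U :: real where "U = fact n / pi ^ n"
  let ?d = "\<lambda>z :: complex ^ 'n. fact n / (pi ^ n * (1 + (norm z)\<^sup>2) ^ (n + 1)) :: real"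
  have U: "0 \<le> U" by (simp add: U_def)
  have dm [measurable]: "(\<lambda>z. ennreal (?d z)) \<in> borel_measurable lborel"
    by measurable
  have bound: "ennreal (?d z) \<le> (\<Sum>m. ennreal (U * q * (1 / q) ^ m) * indicator (ball 0 (2 ^ m)) z)"
    for z
  proof -
    obtain m0 where "norm z < 2 ^ m0" using real_arch_pow[of 2 "norm z"] by auto
    define m where "m = (LEAST m. norm z < 2 ^ m)"
    have m: "norm z < 2 ^ m" unfolding m_def by (rule LeastI) fact
    have "?d z \<le> U * q * (1 / q) ^ m"
    proof (cases m)
      case 0
      have "1 \<le> (1 + (norm z)\<^sup>2) ^ (n + 1)" by (intro one_le_power) simp
      then have "?d z \<le> U" unfolding U_def by (intro divide_left_mono) (auto simp: add_pos_nonneg)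
      also have "\<dots> \<le> U * q" using U mult_left_mono[of 1 q U] by (simp add: q_def one_le_power del: power_Suc)
      finally show ?thesis using 0 by simp
    next
      case (Suc l)
      have "\<not> norm z < 2 ^ l" using not_less_Least[of l "\<lambda>m. norm z < 2 ^ m"] Suc by (simp add: m_def)
      then have "(2 ^ l)\<^sup>2 \<le> (norm z)\<^sup>2" by (intro power_mono) auto
      then have "(4::real) ^ l \<le> 1 + (norm z)\<^sup>2"
        using power_mult_distrib[of 2 "2::real" l] by (simp add: power2_eq_square)
      then have "(4 ^ l) ^ (n + 1) \<le> (1 + (norm z)\<^sup>2) ^ (n + 1)" by (intro power_mono) auto
      also have "((4::real) ^ l) ^ (n + 1) = q ^ l" by (simp add: q_def flip: power_mult)
      finally have "?d z \<le> fact n / (pi ^ n * q ^ l)"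
        by (intro divide_left_mono mult_left_mono) (auto simp: q_def add_pos_nonneg)
      also have "\<dots> = U * q * (1 / q) ^ m"
        by (simp add: U_def Suc power_one_over field_simps) (simp add: q_def)
      finally show ?thesis .
    qed
    then have "ennreal (?d z) \<le> ennreal (U * q * (1 / q) ^ m) * indicator (ball 0 (2 ^ m)) z"
      using m by (simp add: ennreal_leI)
    also have "\<dots> \<le> (\<Sum>m. ennreal (U * q * (1 / q) ^ m) * indicator (ball 0 (2 ^ m)) z)"
      using sum_le_suminf[OF summableI, of "{m}" "\<lambda>m. ennreal (U * q * (1 / q) ^ m) * indicator (ball 0 (2 ^ m)) z"]
      by (simp del: sum_mult_indicator)
    finally show ?thesis .
  qed
  have "emeasure (fs_measure :: 'n cproj measure) UNIV = (\<integral>\<^sup>+z. ennreal (?d z) \<partial>lborel)"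
  proof -
    have "emeasure (fs_measure :: 'n cproj measure) UNIV =
        emeasure (density lborel (\<lambda>z. ennreal (?d z))) UNIV"
      unfolding fs_measure_def n_def using measurable_affine_chart[of None]
      by (subst emeasure_distr) simp_all
    also have "\<dots> = (\<integral>\<^sup>+z. ennreal (?d z) \<partial>lborel)"
      by (subst emeasure_density) auto
    finally show ?thesis .
  qed
  also have "\<dots> \<le> (\<integral>\<^sup>+z. (\<Sum>m. ennreal (U * q * (1 / q) ^ m) * indicator (ball 0 (2 ^ m)) z)
      \<partial>(lborel :: (complex ^ 'n) measure))"
    by (intro nn_integral_mono bound)
  also have "\<dots> = (\<Sum>m. ennreal (U * q * (1 / q) ^ m) * emeasure lborel (ball 0 (2 ^ m) :: (complex ^ 'n) set))"
  proof -
    have [measurable]: "(ball 0 r :: (complex ^ 'n) set) \<in> sets lborel" for r by simp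
    have "(\<lambda>z :: complex ^ 'n. ennreal (U * q * (1 / q) ^ m) * indicator (ball 0 (2 ^ m)) z)
        \<in> borel_measurable lborel" for m by measurable
    then show ?thesis by (subst nn_integral_suminf) (simp_all add: nn_integral_cmult_indicator)
  qed
  also have "\<dots> = (\<Sum>m. ennreal (U * q * unit_ball_vol (real (n * 2)) * (1 / 4) ^ m))"
  proof (rule suminf_cong)
    fix m
    have "(1 / q) ^ m * (2 ^ m) ^ (n * 2) = (1 / 4 :: real) ^ m"
    proof -
      have "((2::real) ^ m) ^ (n * 2) = (4 ^ n) ^ m"
      proof -
        have "((2::real) ^ m) ^ (n * 2) = (2\<^sup>2) ^ (n * m)"
          by (simp only: power_mult[symmetric] mult_ac)
        then show ?thesis by (simp add: power_mult)
      qed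
      then show ?thesis
        by (simp add: q_def power_mult_distrib power_one_over field_simps)
    qed
    then have "U * q * (1 / q) ^ m * (unit_ball_vol (real (n * 2)) * (2 ^ m) ^ (n * 2)) =
        U * q * unit_ball_vol (real (n * 2)) * (1 / 4) ^ m" by (simp add: mult_ac)
    moreover have "emeasure lborel (ball 0 (2 ^ m) :: (complex ^ 'n) set) =
        ennreal (unit_ball_vol (real (n * 2)) * (2 ^ m) ^ (n * 2))"
      by (subst emeasure_ball) (simp_all add: n_def)
    ultimately show "ennreal (U * q * (1 / q) ^ m) * emeasure lborel (ball 0 (2 ^ m) :: (complex ^ 'n) set)
        = ennreal (U * q * unit_ball_vol (real (n * 2)) * (1 / 4) ^ m)"
      using U by (simp add: ennreal_mult'[symmetric] q_def)
  qed
  also have "\<dots> < \<infinity>"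
  proof -
    have "summable (\<lambda>m. U * q * unit_ball_vol (real (n * 2)) * (1 / 4) ^ m)"
      by (intro summable_mult summable_geometric) simp
    then show ?thesis
      using U by (subst suminf_ennreal2) (auto simp: q_def)
  qed
  finally show ?thesis .
qed

section \<open>An extremal competitor\<close>

lemma hermitian_cauchy_schwarz:
  "cmod (\<Sum>i\<in>UNIV. Z $ i * cnj (A $ i)) \<le> norm Z * norm A" for Z A :: "complex ^ 'm::finite"
proof -
  have "cmod (\<Sum>i\<in>UNIV. Z $ i * cnj (A $ i)) \<le> (\<Sum>i\<in>UNIV. \<bar>cmod (Z $ i)\<bar> * \<bar>cmod (A $ i)\<bar>)"
    by (rule order_trans[OF norm_sum]) (simp add: norm_mult)
  also have "\<dots> \<le> norm Z * norm A"
    unfolding norm_vec_def by (rule L2_set_mult_ineq)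
  finally show ?thesis .
qed

text \<open>The coefficient vector \<open>(1, i)\<close> of this form is isotropic: \<open>1\<^sup>2 + i\<^sup>2 = 0\<close>.\<close>

definition isotropic_form :: "'n \<Rightarrow> complex ^ ('n::finite) option \<Rightarrow> complex" where
  "isotropic_form k Z = Z $ None + \<i> * Z $ Some k"

definition competitor_norm :: "'n \<Rightarrow> complex ^ ('n::finite) option \<Rightarrow> real" where
  "competitor_norm k Z = max (norm Z) (cmod (isotropic_form k Z))"

lemma competitor_norm_pos: "Z \<noteq> 0 \<Longrightarrow> 0 < competitor_norm k Z"
  by (simp add: competitor_norm_def less_max_iff_disj)

lemma continuous_competitor_norm: "continuous_on S (competitor_norm k)"
  unfolding competitor_norm_def isotropic_form_def by (intro continuous_intros)

text \<open>
  The norm \<open>\<bar>Z\<bar>\<close> is supported at \<open>A\<close> by the Hermitian product with \<open>A / \<bar>A\<bar>\<close>; the other term of the maximum is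
  the modulus of a linear form already.
\<close>

lemma competitor_norm_support:
  fixes A :: "complex ^ ('n::finite) option"
  obtains f where "\<And>Z W \<zeta>. f (Z + \<zeta> *s W) = f Z + \<zeta> * f W" "\<And>Z. cmod (f Z) \<le> competitor_norm k Z"
    "cmod (f A) = competitor_norm k A"
proof (cases "cmod (isotropic_form k A) \<ge> norm A")
  case True
  show ?thesis
  proof (rule that[of "isotropic_form k"])
    show "isotropic_form k (Z + \<zeta> *s W) = isotropic_form k Z + \<zeta> * isotropic_form k W" for Z W \<zeta>
      by (simp add: isotropic_form_def algebra_simps)
  qed (use True in \<open>auto simp: competitor_norm_def\<close>)
next
  case False
  then have A: "norm A > 0" using norm_ge_zero[of "isotropic_form k A"] by linarith
  define f where "f Z = (\<Sum>i\<in>UNIV. Z $ i * cnj (A $ i)) / of_real (norm A)" for Z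
  show ?thesis
  proof (rule that[of f])
    show "f (Z + \<zeta> *s W) = f Z + \<zeta> * f W" for Z W \<zeta>
      by (simp add: f_def sum.distrib sum_distrib_left algebra_simps add_divide_distrib)
    have "cmod (f Z) \<le> norm Z" for Z
      using hermitian_cauchy_schwarz[of Z A] A by (simp add: f_def norm_divide field_simps)
    then show "cmod (f Z) \<le> competitor_norm k Z" for Z
      by (simp add: competitor_norm_def le_max_iff_disj)
    have "(\<Sum>i\<in>UNIV. A $ i * cnj (A $ i)) = of_real ((norm A)\<^sup>2)"
      by (simp add: norm_sq_vec complex_norm_square flip: of_real_power)
    then have "f A = of_real (norm A)"
      using A by (simp add: f_def power2_eq_square)
    then show "cmod (f A) = competitor_norm k A"
      using False by (simp add: competitor_norm_def max_def)
  qed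
qed

lemma competitor_norm_mean:
  fixes A B :: "complex ^ ('n::finite) option"
  assumes "\<And>\<zeta>. A + \<zeta> *s B \<noteq> 0"
  shows "ln (competitor_norm k A) \<le> integral\<^sup>L circ (\<lambda>\<theta>. ln (competitor_norm k (A + cis \<theta> *s B)))"
proof -
  obtain f where f: "\<And>Z W \<zeta>. f (Z + \<zeta> *s W) = f Z + \<zeta> * f W"
    "\<And>Z. cmod (f Z) \<le> competitor_norm k Z" "cmod (f A) = competitor_norm k A"
    using competitor_norm_support[where k = k and A = A] by blast
  have "ln (competitor_norm k (A + 0 *s B)) \<le> integral\<^sup>L circ (\<lambda>\<theta>. ln (competitor_norm k (A + cis \<theta> *s B)))"
  proof (rule log_mean_ge_dominating[where \<alpha> = "f A" and \<beta> = "f B"])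
    show "continuous_on (cball 0 1) (\<lambda>\<zeta>. competitor_norm k (A + \<zeta> *s B))"
      unfolding vector_scalar_mult_def
      by (intro continuous_on_compose2[OF continuous_competitor_norm[of UNIV]] continuous_intros) auto
    show "cmod (f A + \<zeta> * f B) \<le> competitor_norm k (A + \<zeta> *s B)" for \<zeta>
      using f(2)[of "A + \<zeta> *s B"] by (simp add: f(1))
  qed (use assms competitor_norm_pos f(3) in auto)
  then show ?thesis by simp
qed

text \<open>
  The quotient is homogeneous of degree \<open>0\<close>, so the representative chosen by \<open>cproj_rep\<close> does not matter
  (lemma \<open>competitor_hom_point\<close>).
\<close>

definition competitor :: "'n \<Rightarrow> ('n::finite) cproj \<Rightarrow> real" where
  "competitor k x = ln (competitor_norm k (cproj_rep x) / norm (cproj_rep x))"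

lemma competitor_hom_point:
  assumes "Z \<noteq> 0"
  shows "competitor k (hom_point Z) = ln (competitor_norm k Z / norm Z)"
proof -
  let ?W = "cproj_rep (hom_point Z)"
  have W: "?W \<noteq> 0"
    using Quotient3_rep_reflp[OF Quotient3_cproj, of "hom_point Z"] by (simp add: proportional_def)
  moreover have "hom_point ?W = hom_point Z"
    by (rule Quotient3_abs_rep[OF Quotient3_cproj])
  ultimately obtain c where c: "c \<noteq> 0" "Z = c *s ?W"
    using hom_point_eq_iff[OF W assms] by blast
  have "isotropic_form k (c *s X) = c * isotropic_form k X" for X
    by (simp add: isotropic_form_def algebra_simps)
  then have "competitor_norm k (c *s ?W) = cmod c * competitor_norm k ?W"
    by (simp add: competitor_norm_def norm_scale norm_mult max_mult_distrib_left)
  then have "competitor_norm k Z / norm Z = competitor_norm k ?W / norm ?W"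
    using c by (metis norm_scale mult_divide_mult_cancel_left norm_eq_zero)
  then show ?thesis by (simp add: competitor_def)
qed

lemma continuous_competitor: "continuous_on UNIV (competitor k)"
proof (rule continuous_on_cproj)
  have "continuous_on (- {0}) (\<lambda>Z. ln (competitor_norm k Z / norm Z))"
    using less_imp_neq[OF competitor_norm_pos, of _ k]
    by (intro continuous_intros continuous_competitor_norm) auto
  then show "continuous_on (- {0}) (\<lambda>Z. competitor k (hom_point Z))"
    by (rule continuous_on_eq) (simp add: competitor_hom_point)
qed

lemma cmod_isotropic_form_le: "(cmod (isotropic_form k Z))\<^sup>2 \<le> 2 * (norm Z)\<^sup>2"
proof -
  have "(cmod (isotropic_form k Z))\<^sup>2 \<le> (cmod (Z $ None) + cmod (Z $ Some k))\<^sup>2"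
    unfolding isotropic_form_def using norm_triangle_ineq[of "Z $ None" "\<i> * Z $ Some k"]
    by (intro power_mono) (auto simp: norm_mult)
  also have "\<dots> \<le> 2 * ((cmod (Z $ None))\<^sup>2 + (cmod (Z $ Some k))\<^sup>2)"
    using zero_le_power2[of "cmod (Z $ None) - cmod (Z $ Some k)"]
    by (simp add: power2_eq_square algebra_simps)
  also have "(cmod (Z $ Some k))\<^sup>2 \<le> (\<Sum>k\<in>UNIV. (cmod (Z $ Some k))\<^sup>2)"
    by (rule member_le_sum) auto
  then have "2 * ((cmod (Z $ None))\<^sup>2 + (cmod (Z $ Some k))\<^sup>2) \<le> 2 * (norm Z)\<^sup>2"
    by (simp add: norm_sq_vec sum_option)
  finally show ?thesis .
qed

lemma competitor_bounds: "0 \<le> competitor k x" "competitor k x \<le> ln 2 / 2"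
proof -
  obtain Z where Z: "Z \<noteq> 0" "x = hom_point Z" by (rule cproj_cases)
  have "1 \<le> competitor_norm k Z / norm Z" using Z(1) by (simp add: competitor_norm_def)
  then show "0 \<le> competitor k x"
    using Z by (simp add: competitor_hom_point)
  have "competitor_norm k Z \<le> sqrt 2 * norm Z"
  proof -
    have "cmod (isotropic_form k Z) \<le> sqrt (2 * (norm Z)\<^sup>2)"
      by (rule real_le_rsqrt[OF cmod_isotropic_form_le])
    moreover have "norm Z \<le> sqrt 2 * norm Z"
      using mult_right_mono[of 1 "sqrt 2" "norm Z"] by simp
    ultimately show ?thesis by (simp add: competitor_norm_def real_sqrt_mult)
  qed
  then have "ln (competitor_norm k Z / norm Z) \<le> ln (sqrt 2)"
    using Z(1) competitor_norm_pos[OF Z(1), of k] by (intro ln_mono) (auto simp: field_simps)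
  also have "ln (sqrt 2) = ln 2 / (2::real)" by (simp add: ln_sqrt)
  finally show "competitor k x \<le> ln 2 / 2"
    using Z by (simp add: competitor_hom_point)
qed

lemma competitor_real:
  assumes "x \<in> real_points"
  shows "competitor k x = 0"
proof -
  obtain Z where Z: "Z \<noteq> 0" "x = hom_point Z" "\<And>i. Z $ i \<in> \<real>"
    using assms unfolding real_points_def by blast
  obtain s t where st: "Z $ None = of_real s" "Z $ Some k = of_real t"
    using Z(3) by (meson Reals_cases)
  have "(cmod (isotropic_form k Z))\<^sup>2 = (cmod (Z $ None))\<^sup>2 + (cmod (Z $ Some k))\<^sup>2"
    by (simp add: isotropic_form_def st cmod_power2)
  also have "(cmod (Z $ Some k))\<^sup>2 \<le> (\<Sum>k\<in>UNIV. (cmod (Z $ Some k))\<^sup>2)"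
    by (rule member_le_sum) auto
  then have "(cmod (Z $ None))\<^sup>2 + (cmod (Z $ Some k))\<^sup>2 \<le> (norm Z)\<^sup>2"
    by (simp add: norm_sq_vec sum_option)
  finally have "cmod (isotropic_form k Z) \<le> norm Z"
    by (rule power2_le_imp_le) simp
  then show ?thesis
    using Z(1,2) by (simp add: competitor_hom_point competitor_norm_def max_def)
qed

lemma competitor_attained: "\<exists>x. competitor k x = ln 2 / 2"
proof
  let ?Z = "(\<chi> i. if i = None then 1 else if i = Some k then - \<i> else 0) :: complex ^ 'a option"
  have Z: "?Z \<noteq> 0" by (auto simp: vec_eq_iff intro!: exI[of _ None])
  have "(norm ?Z)\<^sup>2 = 1 + (\<Sum>l\<in>UNIV. if l = k then 1 else 0)"
    unfolding norm_sq_vec sum_option by (simp add: if_distrib[of cmod] if_distrib[of "\<lambda>x. x\<^sup>2"] cong: if_cong)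
  then have n: "norm ?Z = sqrt 2" by (intro real_sqrt_unique[symmetric]) auto
  have "isotropic_form k ?Z = 2" by (simp add: isotropic_form_def)
  then have "competitor_norm k ?Z / norm ?Z = 2 / sqrt 2"
    using real_sqrt_le_mono[of 2 4] by (simp add: competitor_norm_def n max_def)
  also have "\<dots> = sqrt 2" by (simp add: real_div_sqrt)
  finally show "competitor k (hom_point ?Z) = ln 2 / 2"
    using Z by (simp add: competitor_hom_point ln_sqrt)
qed

lemma ereal_usc_continuous:
  assumes "continuous_on UNIV f"
  shows "usc_on UNIV (\<lambda>x. ereal (f x))"
  unfolding usc_on_UNIV
proof
  fix c
  have "continuous_on UNIV (\<lambda>x. ereal (f x))" using assms by (intro continuous_intros)
  then have "open ((\<lambda>x. ereal (f x)) -` {..<c})" by (intro open_vimage) auto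
  then show "open {x. ereal (f x) < c}" by (simp add: vimage_def)
qed

lemma competitor_psh:
  "psh_on UNIV (\<lambda>z. ereal (u0 z) + ereal (competitor k (affine_chart j z)))"
proof -
  have e: "ereal (u0 z) + ereal (competitor k (affine_chart j z)) =
      ereal (ln (competitor_norm k (chart_lift j z)))" for z
  proof -
    have "competitor k (affine_chart j z) =
        ln (competitor_norm k (chart_lift j z)) - ln (norm (chart_lift j z))"
      using chart_lift_nonzero[of j z] competitor_norm_pos[OF chart_lift_nonzero, of k j z]
      by (simp add: affine_chart_lift competitor_hom_point ln_div)
    then show ?thesis by (simp add: u0_chart_lift[of z j])
  qed
  have cont: "continuous_on UNIV (\<lambda>z. ln (competitor_norm k (chart_lift j z)))"
    using less_imp_neq[OF competitor_norm_pos[OF chart_lift_nonzero], of k j]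
    by (intro continuous_intros
        continuous_on_compose2[OF continuous_competitor_norm[of UNIV] continuous_chart_lift]) auto
  have "ereal (ln (competitor_norm k (chart_lift j a))) \<le>
      ereal_integral circ (\<lambda>\<theta>. ereal (ln (competitor_norm k (chart_lift j (a + cis \<theta> *s b)))))" for a b
  proof -
    have "continuous_on UNIV (\<lambda>\<theta>. a + cis \<theta> *s b)"
      unfolding vector_scalar_mult_def by (intro continuous_intros)
    then have "integrable circ (\<lambda>\<theta>. ln (competitor_norm k (chart_lift j (a + cis \<theta> *s b))))"
      by (intro integral_circ continuous_on_compose2[OF cont]) auto
    moreover have "ln (competitor_norm k (chart_lift j a)) \<le>
        integral\<^sup>L circ (\<lambda>\<theta>. ln (competitor_norm k (chart_lift j (a + cis \<theta> *s b))))"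
      unfolding chart_lift_affine
      by (rule competitor_norm_mean) (simp only: chart_lift_affine[symmetric] chart_lift_nonzero not_False_eq_True)
    ultimately show ?thesis by (simp add: ereal_integral_real)
  qed
  then show ?thesis
    unfolding psh_on_def e using ereal_usc_continuous[OF cont] by simp
qed

lemma competitor_PSH_omega: "(\<lambda>x. ereal (competitor k x)) \<in> PSH_omega"
proof -
  have m: "(\<lambda>x. ereal (competitor k x)) \<in> borel_measurable fs_measure"
    using borel_measurable_continuous_onI[OF continuous_competitor[of k]]
    by (simp add: fs_measure_def)
  have "(\<integral>\<^sup>+x. e2ennreal \<bar>ereal (competitor k x)\<bar> \<partial>fs_measure) \<le>
      (\<integral>\<^sup>+x. ennreal (ln 2 / 2) \<partial>(fs_measure :: 'a cproj measure))"
    using competitor_bounds[of k] by (intro nn_integral_mono) (simp only: abs_ereal.simps e2ennreal_ereal, simp add: ennreal_leI)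
  also have "\<dots> < \<infinity>"
    using fs_measure_finite[where 'n = 'a] by (simp add: ennreal_mult_less_top fs_measure_def)
  finally have "L1_fs (\<lambda>x. ereal (competitor k x))"
    using m by (simp add: L1_fs_def)
  then show ?thesis
    using competitor_psh[of k] ereal_usc_continuous[OF continuous_competitor[of k]]
    by (simp add: PSH_omega_def ddc_plus_omega_nonneg_def)
qed

section \<open>The capacity\<close>

theorem mainTheorem4:
  "alexander_capacity (real_points :: ('n::finite) cproj set) = 1 / sqrt 2"
proof -
  let ?E = "extremal_function (real_points :: 'n cproj set)"
  have "(SUP x. ?E x) = ereal (ln 2 / 2)"
  proof (rule antisym)
    show "(SUP x. ?E x) \<le> ereal (ln 2 / 2)"
      unfolding extremal_function_def by (intro SUP_least competitor_le) auto
    obtain k :: 'n and x where x: "competitor k x = ln 2 / 2"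
      using competitor_attained by blast
    have "ereal (competitor k x) \<le> ?E x"
      unfolding extremal_function_def
      by (rule SUP_upper2[OF _ order_refl, of "\<lambda>x. ereal (competitor k x)" _ "\<lambda>\<phi>. \<phi> x"])
        (simp add: competitor_PSH_omega competitor_real)
    also have "?E x \<le> (SUP x. ?E x)" by (rule SUP_upper) simp
    finally show "ereal (ln 2 / 2) \<le> (SUP x. ?E x)" by (simp only: x)
  qed
  moreover have "exp (- (ln 2 / 2)) = 1 / sqrt (2::real)"
    by (simp add: exp_minus ln_sqrt[symmetric] inverse_eq_divide)
  ultimately show ?thesis
    by (simp add: alexander_capacity_def)
qed

end
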